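(* Let $1\le p<\infty$ and let $S\colon\ell_p\to\ell_p$ be a quasinilpotent operator whose modulus $|S|$ exists. Suppose that $S$ has no invariant ideals and that the negative part $S^-$ is compact. Then $r(|S|)$ is a positive eigenvalue of $|S|$ corresponding to a positive eigenvector. In particular, $|S|$ has an invariant subspace.
   Context: All operators are linear and continuous. $\ell_p$ carries its usual coordinatewise Banach lattice order. A linear operator on a Banach lattice is positive if it maps positive vectors to positive vectors. For operators, $A\le B$ means that $B-A$ is positive. The modulus $|S|$ is the supremum of $S$ and $-S$ in this order (when it exists), $S^+=\tfrac12(|S|+S)$ and $S^-=\tfrac12(|S|-S)$, so $S=S^+-S^-$ and $|S|=S^++S^-$. Here $S$ is a real operator, i.e. its matrix with respect to the standard unit vectors has real entries; then the matrices of $|S|,S^+,S^-$ are obtained by taking the modulus, positive part and negative part of each entry. The spectral radius is $r(S)=\lim_n\|S^n\|^{1/n}$, and $S$ is quasinilpotent if $r(S)=0$. An invariant subspace of an operator means a closed subspace, different from $\{0\}$ and from the whole space, that is mapped into itself by the operator. An invariant ideal is a closed lattice (order) ideal, different from $\{0\}$ and from the whole space, that is mapped into itself by the operator. A positive eigenvector is an eigenvector that is a (non-zero) positive vector. *)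

theory Defs
  imports "HOL-Analysis.Analysis"
begin

text \<open>
  The scalars are an arbitrary type \<open>'a\<close> of class \<open>{real_normed_field, banach}\<close>, so that the real and
  the complex sequence spaces are covered simultaneously. The set \<open>\<real>\<^sub>\<ge>\<^sub>0\<close> is the image of
  \<open>{0..}\<close> under \<open>of_real\<close>.

  The exponent is a variable, so the sequence space is a carrier set and not a type. Operators are
  functions on all sequences, of which only the restriction to the carrier matters.
\<close>

definition lp :: "real \<Rightarrow> (nat \<Rightarrow> 'a::{real_normed_field, banach}) set" where
  "lp p = {x. summable (\<lambda>n. norm (x n) powr p)}"

definition lp_norm :: "real \<Rightarrow> (nat \<Rightarrow> 'a::{real_normed_field, banach}) \<Rightarrow> real" where
  "lp_norm p x = (\<Sum>n. norm (x n) powr p) powr (1 / p)"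

definition lp_topology :: "real \<Rightarrow> (nat \<Rightarrow> 'a::{real_normed_field, banach}) topology" where
  "lp_topology p = Metric_space.mtopology (lp p) (\<lambda>x y. lp_norm p (\<lambda>n. x n - y n))"

definition lp_unit_ball :: "real \<Rightarrow> (nat \<Rightarrow> 'a::{real_normed_field, banach}) set" where
  "lp_unit_ball p = {x \<in> lp p. lp_norm p x \<le> 1}"

definition unit_seq :: "nat \<Rightarrow> nat \<Rightarrow> 'a::{real_normed_field, banach}" where
  "unit_seq j = (\<lambda>i. if i = j then 1 else 0)"

definition lp_pos :: "real \<Rightarrow> (nat \<Rightarrow> 'a::{real_normed_field, banach}) set" where
  "lp_pos p = {x \<in> lp p. \<forall>n. x n \<in> \<real>\<^sub>\<ge>\<^sub>0}"


type_synonym 'a seq_op = "(nat \<Rightarrow> 'a) \<Rightarrow> (nat \<Rightarrow> 'a)"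

definition lp_operator :: "real \<Rightarrow> 'a::{real_normed_field, banach} seq_op \<Rightarrow> bool" where
  "lp_operator p T \<longleftrightarrow>
     (\<forall>x \<in> lp p. T x \<in> lp p) \<and>
     (\<forall>x \<in> lp p. \<forall>y \<in> lp p. T (\<lambda>n. x n + y n) = (\<lambda>n. T x n + T y n)) \<and>
     (\<forall>c. \<forall>x \<in> lp p. T (\<lambda>n. c * x n) = (\<lambda>n. c * T x n)) \<and>
     (\<exists>C. \<forall>x \<in> lp p. lp_norm p (T x) \<le> C * lp_norm p x)"

definition real_operator :: "'a::{real_normed_field, banach} seq_op \<Rightarrow> bool" where
  "real_operator T \<longleftrightarrow> (\<forall>i j. T (unit_seq j) i \<in> \<real>)"

definition lp_positive :: "real \<Rightarrow> 'a::{real_normed_field, banach} seq_op \<Rightarrow> bool" where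
  "lp_positive p T \<longleftrightarrow> (\<forall>x \<in> lp_pos p. T x \<in> lp_pos p)"

definition lp_op_le :: "real \<Rightarrow> 'a::{real_normed_field, banach} seq_op \<Rightarrow> 'a seq_op \<Rightarrow> bool" where
  "lp_op_le p A B \<longleftrightarrow> lp_positive p (\<lambda>x n. B x n - A x n)"

text \<open>
  \<open>lp_modulus p S M\<close>: the supremum of \<open>S\<close> and \<open>-S\<close> among the bounded operators exists and is \<open>M\<close>.
\<close>
definition lp_modulus :: "real \<Rightarrow> 'a::{real_normed_field, banach} seq_op \<Rightarrow> 'a seq_op \<Rightarrow> bool" where
  "lp_modulus p S M \<longleftrightarrow>
     lp_operator p M \<and> lp_op_le p S M \<and> lp_op_le p (\<lambda>x n. - S x n) M \<and>
     (\<forall>B. lp_operator p B \<and> lp_op_le p S B \<and> lp_op_le p (\<lambda>x n. - S x n) B \<longrightarrow> lp_op_le p M B)"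

text \<open>The second argument stands for the modulus of the first.\<close>
definition neg_part :: "'a::{real_normed_field, banach} seq_op \<Rightarrow> 'a seq_op \<Rightarrow> 'a seq_op" where
  "neg_part S M = (\<lambda>x n. (M x n - S x n) / 2)"

definition lp_compact_op :: "real \<Rightarrow> 'a::{real_normed_field, banach} seq_op \<Rightarrow> bool" where
  "lp_compact_op p T \<longleftrightarrow>
     compactin (lp_topology p) (lp_topology p closure_of (T ` lp_unit_ball p))"

definition lp_opnorm :: "real \<Rightarrow> 'a::{real_normed_field, banach} seq_op \<Rightarrow> real" where
  "lp_opnorm p T = (SUP x \<in> lp_unit_ball p. lp_norm p (T x))"

definition spectral_radius :: "real \<Rightarrow> 'a::{real_normed_field, banach} seq_op \<Rightarrow> real" where
  "spectral_radius p T = lim (\<lambda>n. root n (lp_opnorm p (T ^^ n)))"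

definition quasinilpotent :: "real \<Rightarrow> 'a::{real_normed_field, banach} seq_op \<Rightarrow> bool" where
  "quasinilpotent p T \<longleftrightarrow> spectral_radius p T = 0"


definition lp_closed_subspace :: "real \<Rightarrow> (nat \<Rightarrow> 'a::{real_normed_field, banach}) set \<Rightarrow> bool" where
  "lp_closed_subspace p V \<longleftrightarrow>
     V \<subseteq> lp p \<and> (\<lambda>n. 0) \<in> V \<and>
     (\<forall>x \<in> V. \<forall>y \<in> V. (\<lambda>n. x n + y n) \<in> V) \<and>
     (\<forall>c. \<forall>x \<in> V. (\<lambda>n. c * x n) \<in> V) \<and>
     closedin (lp_topology p) V"

definition invariant_subspace ::
  "real \<Rightarrow> 'a::{real_normed_field, banach} seq_op \<Rightarrow> (nat \<Rightarrow> 'a) set \<Rightarrow> bool" where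
  "invariant_subspace p T V \<longleftrightarrow>
     lp_closed_subspace p V \<and> V \<noteq> {\<lambda>n. 0} \<and> V \<noteq> lp p \<and> T ` V \<subseteq> V"

definition lp_solid :: "real \<Rightarrow> (nat \<Rightarrow> 'a::{real_normed_field, banach}) set \<Rightarrow> bool" where
  "lp_solid p V \<longleftrightarrow> (\<forall>x \<in> V. \<forall>y \<in> lp p. (\<forall>n. norm (y n) \<le> norm (x n)) \<longrightarrow> y \<in> V)"

definition invariant_ideal ::
  "real \<Rightarrow> 'a::{real_normed_field, banach} seq_op \<Rightarrow> (nat \<Rightarrow> 'a) set \<Rightarrow> bool" where
  "invariant_ideal p T V \<longleftrightarrow> invariant_subspace p T V \<and> lp_solid p V"

definition lp_eigenvector ::
  "real \<Rightarrow> 'a::{real_normed_field, banach} seq_op \<Rightarrow> 'a \<Rightarrow> (nat \<Rightarrow> 'a) \<Rightarrow> bool" where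
  "lp_eigenvector p T c v \<longleftrightarrow> v \<in> lp p \<and> v \<noteq> (\<lambda>n. 0) \<and> T v = (\<lambda>n. c * v n)"

end

theory Submission
  imports Defs
begin

text \<open>
  Write \<open>M\<close> for the modulus of \<open>S\<close>, \<open>K\<close> for the negative part and \<open>r\<close> for the spectral radius
  of \<open>M\<close>. Then \<open>M\<close> is positive and \<open>M = S + 2 * K\<close>: it differs by a compact operator from an
  operator whose spectrum is \<open>{0}\<close>. So every nonzero spectral value of \<open>M\<close> should be an eigenvalue,
  and the largest one of a positive operator should have a positive eigenvector. Two things have to
  be shown: that \<open>r\<close> is not zero, and that the eigenvector exists.

  For \<open>r > 0\<close> the sequence space helps. For every set \<open>A\<close> of indices the sequences supported in
  \<open>A\<close> form a closed ideal, so if \<open>S\<close> has no invariant ideals then no nontrivial \<open>A\<close> is closed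
  under the nonzero entries of the matrix of \<open>S\<close>, hence none under those of the larger matrix of
  \<open>M\<close>. In the directed graph of nonzero entries the indices reachable from a given index
  form a closed set, so every index lies on a cycle (\<open>irreducible_cycle\<close>). If \<open>n\<close> is its length,
  the \<open>k\<close>-th powers of a positive diagonal entry of \<open>M ^^ n\<close> bound the norm of
  \<open>M ^^ (n * k)\<close> from below, and the spectral radius is positive
  (\<open>spectral_radius_pos_of_cycle\<close>).

  For the eigenvector, the first step is that \<open>r\<close> is an approximate eigenvalue with positive
  approximate eigenvectors (\<open>approximate_eigenvector\<close>). These are finite sums of
  \<open>u k * r ^ (- k) * M ^^ k x\<close> with slowly varying weights \<open>u\<close>: applying \<open>r - M\<close> amounts to taking
  differences of the weights, which are small compared with the weights, and positivity prevents
  cancellation in the sum itself. The second step is the usual compactness argument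
  (\<open>positive_eigenvector_of_compact_perturbation\<close>): for normalised approximate eigenvectors \<open>v k\<close>,
  \<open>(r - S) (v k) = (r - M) (v k) + 2 * K (v k)\<close> converges along a subsequence, and \<open>r - S\<close> is
  bounded below because some power of \<open>S\<close> has norm less than the same power of \<open>r\<close>
  (\<open>lp_bounded_below_outside_spectrum\<close>). Hence \<open>v k\<close> converges along that subsequence, and its limit
  is a positive eigenvector. The multiples of this eigenvector are an invariant subspace.
\<close>

section \<open>Submultiplicative sequences\<close>

text \<open>
  By division with remainder \<open>n = k * m + s\<close>, the bound at \<open>m\<close> propagates to all \<open>n\<close>; the
  constant absorbs the finitely many remainders.
\<close>

lemma submultiplicative_growth:
  fixes a :: "nat \<Rightarrow> real"
  assumes nonneg: "\<And>n. 0 \<le> a n"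
    and submult: "\<And>m n. a (m + n) \<le> a m * a n"
    and m: "0 < m" and q: "0 < q" "a m \<le> q ^ m"
  obtains C where "0 < C" "\<And>n. a n \<le> C * q ^ n"
proof -
  define C where "C = 1 + (\<Sum>s<m. a s / q ^ s)"
  have "0 \<le> (\<Sum>s<m. a s / q ^ s)"
    using nonneg q by (intro sum_nonneg) auto
  then have "0 < C" by (simp add: C_def)
  have small: "a s \<le> C * q ^ s" if "s < m" for s
  proof -
    have "a s / q ^ s \<le> (\<Sum>s<m. a s / q ^ s)"
      using that nonneg q by (intro member_le_sum) auto
    then have "a s / q ^ s \<le> C" by (simp add: C_def)
    then show ?thesis using q by (simp add: field_simps)
  qed
  have step: "a (k * m + s) \<le> C * q ^ (k * m + s)" if "s < m" for k s
  proof (induction k)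
    case 0
    show ?case using small that by simp
  next
    case (Suc k)
    have "a (Suc k * m + s) \<le> a m * a (k * m + s)"
      using submult[of m "k * m + s"] by (simp add: algebra_simps)
    also have "\<dots> \<le> q ^ m * (C * q ^ (k * m + s))"
      using Suc q nonneg by (intro mult_mono) auto
    finally show ?case by (simp add: power_add algebra_simps)
  qed
  have "a n \<le> C * q ^ n" for n
    using step[of "n mod m" "n div m"] m by simp
  with \<open>0 < C\<close> show ?thesis using that by blast
qed

text \<open>
  Fekete's lemma in multiplicative form, including sequences that reach zero. The limit is the
  infimum of the roots, which gives the lower bound at every single index.
\<close>

lemma submultiplicative_root_limit:
  fixes a :: "nat \<Rightarrow> real"
  assumes nonneg: "\<And>n. 0 \<le> a n"
    and submult: "\<And>m n. a (m + n) \<le> a m * a n"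
  obtains L where "(\<lambda>n. root n (a n)) \<longlonglongrightarrow> L" "0 \<le> L"
    "\<And>n. 0 < n \<Longrightarrow> L ^ n \<le> a n"
proof -
  define L where "L = (INF n\<in>{0<..}. root n (a n))"
  have bdd: "bdd_below ((\<lambda>n. root n (a n)) ` {0<..})"
    using nonneg by (intro bdd_belowI2[of _ 0]) auto
  have L_le: "L \<le> root n (a n)" if "0 < n" for n
    unfolding L_def using bdd that by (intro cINF_lower) auto
  have L0: "0 \<le> L"
    unfolding L_def using nonneg by (intro cINF_greatest) auto
  have lower: "L ^ n \<le> a n" if "0 < n" for n
  proof -
    have "L ^ n \<le> root n (a n) ^ n" using L_le L0 that by (intro power_mono) auto
    then show ?thesis using that nonneg by simp
  qed
  have "(\<lambda>n. root n (a n)) \<longlonglongrightarrow> L"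
  proof (rule order_tendstoI)
    fix x assume "x < L"
    have "x < root n (a n)" if "1 \<le> n" for n
      using L_le[of n] \<open>x < L\<close> that by linarith
    then show "\<forall>\<^sub>F n in sequentially. x < root n (a n)"
      by (rule eventually_sequentiallyI)
  next
    fix x assume "L < x"
    define q where "q = (L + x) / 2"
    have q: "L < q" "q < x" "0 < q" using \<open>L < x\<close> L0 by (auto simp: q_def)
    obtain m where m: "0 < m" "root m (a m) < q"
      using q(1) unfolding L_def by (subst (asm) cINF_less_iff[OF _ bdd]) auto
    then have "root m (a m) ^ m \<le> q ^ m" using nonneg by (intro power_mono) auto
    then have "a m \<le> q ^ m" using m nonneg by simp
    then obtain C where C: "0 < C" "\<And>n. a n \<le> C * q ^ n"
      using submultiplicative_growth[OF nonneg submult m(1) q(3)] by blast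
    have "(\<lambda>n. root n C * q) \<longlonglongrightarrow> 1 * q"
      using C by (intro tendsto_mult LIMSEQ_root_const tendsto_const) auto
    then have "\<forall>\<^sub>F n in sequentially. root n C * q < x"
      using q by (intro order_tendstoD) auto
    then show "\<forall>\<^sub>F n in sequentially. root n (a n) < x"
      using eventually_gt_at_top[of 0]
    proof eventually_elim
      case (elim n)
      have "root n (a n) \<le> root n (C * q ^ n)" using C elim by simp
      also have "\<dots> = root n C * q"
        using elim q by (simp add: real_root_mult real_root_power_cancel)
      finally show ?case using elim by simp
    qed
  qed
  with L0 lower show ?thesis using that by blast
qed

section \<open>Real and scalar inequalities\<close>

text \<open>
  Convexity of the power on the closed half-line, in the form in which it gives Minkowski's
  inequality. The endpoint \<open>0\<close> needs its own argument.
\<close>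

lemma powr_convex_combination:
  fixes p :: real
  assumes p: "1 \<le> p" and st: "0 \<le> s" "0 \<le> t" "s + t = 1" and xy: "0 \<le> x" "0 \<le> y"
  shows "(s * x + t * y) powr p \<le> s * x powr p + t * y powr p"
proof -
  have scale: "(u * z) powr p \<le> u * z powr p" if "0 \<le> u" "u \<le> 1" "0 \<le> z" for u z :: real
  proof -
    have "u powr p \<le> u powr 1"
      using that p by (intro powr_mono') auto
    then show ?thesis
      using that by (simp add: powr_mult mult_right_mono)
  qed
  consider "x = 0" | "y = 0" | "0 < x" "0 < y" using xy by linarith
  then show ?thesis
  proof cases
    case 3
    have "s = 1 - t" using st by linarith
    show ?thesis
      unfolding \<open>s = 1 - t\<close>
      using convex_onD[OF powr_convex[OF p], of t x y] st 3 by simp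
  qed (use scale[of t y] scale[of s x] st xy p in auto)
qed

lemma powr_le_powr_iff:
  fixes a b p :: real
  assumes "0 < p" "0 \<le> a" "0 \<le> b"
  shows "a powr p \<le> b powr p \<longleftrightarrow> a \<le> b"
  using assms powr_mono2[of p a b] powr_less_mono2[of p b a] by linarith

text \<open>
  Over an arbitrary scalar field there is no order to compute with. This equation makes
  nonnegative scalars interchangeable with their norms.
\<close>

lemma nonneg_Reals_iff_norm: "x \<in> \<real>\<^sub>\<ge>\<^sub>0 \<longleftrightarrow> x = of_real (norm x)"
  for x :: "'a::real_normed_algebra_1"
proof
  assume "x \<in> \<real>\<^sub>\<ge>\<^sub>0"
  then show "x = of_real (norm x)" by (auto elim: nonneg_Reals_cases)
next
  assume "x = of_real (norm x)"
  then show "x \<in> \<real>\<^sub>\<ge>\<^sub>0" by (metis nonneg_Reals_of_real_iff norm_ge_zero)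
qed

lemma nonneg_Reals_norm_mono:
  fixes x y :: "'a::real_normed_algebra_1"
  assumes "x \<in> \<real>\<^sub>\<ge>\<^sub>0" "y - x \<in> \<real>\<^sub>\<ge>\<^sub>0"
  shows "norm x \<le> norm y"
proof -
  obtain s where s: "x = of_real s" "0 \<le> s" using assms(1) by (auto elim: nonneg_Reals_cases)
  obtain t where t: "y - x = of_real t" "0 \<le> t" using assms(2) by (auto elim: nonneg_Reals_cases)
  have "y = of_real (s + t)" using s t by (simp add: algebra_simps)
  then have "norm y = s + t" using s t by (simp only: norm_of_real abs_of_nonneg add_nonneg_nonneg)
  then show ?thesis using s t by simp
qed

lemma nonneg_Reals_limit:
  fixes x :: "'a::real_normed_algebra_1"
  assumes "X \<longlonglongrightarrow> x" "\<And>k. X k \<in> \<real>\<^sub>\<ge>\<^sub>0"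
  shows "x \<in> \<real>\<^sub>\<ge>\<^sub>0"
proof -
  have "(\<lambda>k. of_real (norm (X k))) \<longlonglongrightarrow> (of_real (norm x) :: 'a)"
    by (intro tendsto_of_real tendsto_norm assms(1))
  moreover have "(\<lambda>k. of_real (norm (X k))) = X"
    by (rule ext) (rule nonneg_Reals_iff_norm[THEN iffD1, OF assms(2), symmetric])
  ultimately have "X \<longlonglongrightarrow> of_real (norm x)"
    by simp
  then show ?thesis
    using LIMSEQ_unique[OF assms(1)] by (intro nonneg_Reals_iff_norm[THEN iffD2])
qed

text \<open>
  Summation by parts moves the difference from \<open>b\<close> to the weights. With \<open>b\<close> the orbit of a
  coordinate under a positive operator scaled by the spectral radius, this says that a weighted sum
  of the orbit is almost fixed if the weights vary slowly.
\<close>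

lemma weighted_telescope_bound:
  fixes u b :: "nat \<Rightarrow> real"
  assumes b: "\<And>k. 0 \<le> b k" and u: "\<And>k. 0 \<le> u k"
    and d: "\<And>k. \<bar>u (Suc k) - u k\<bar> \<le> d * u (Suc k)" "0 \<le> d"
  shows "\<bar>\<Sum>k\<le>N. u k * (b k - b (Suc k))\<bar>
    \<le> u 0 * b 0 + d * (\<Sum>k\<le>N. u k * b k) + u N * b (Suc N)"
proof -
  have abel: "(\<Sum>k\<le>N. u k * (b k - b (Suc k)))
      = u 0 * b 0 + (\<Sum>k<N. (u (Suc k) - u k) * b (Suc k)) - u N * b (Suc N)"
    by (induction N) (simp_all add: algebra_simps)
  have "\<bar>\<Sum>k<N. (u (Suc k) - u k) * b (Suc k)\<bar> \<le> (\<Sum>k<N. d * (u (Suc k) * b (Suc k)))"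
  proof (rule order_trans[OF sum_abs sum_mono])
    fix k
    show "\<bar>(u (Suc k) - u k) * b (Suc k)\<bar> \<le> d * (u (Suc k) * b (Suc k))"
      using mult_right_mono[OF d(1) b] b by (simp add: abs_mult mult.assoc)
  qed
  also have "\<dots> = d * (\<Sum>k<N. u (Suc k) * b (Suc k))"
    by (simp add: sum_distrib_left)
  also have "(\<Sum>k<N. u (Suc k) * b (Suc k)) = (\<Sum>k\<le>N. u k * b k) - u 0 * b 0"
    by (simp add: sum.atMost_shift)
  also have "d * \<dots> \<le> d * (\<Sum>k\<le>N. u k * b k)"
    using b u d(2) by (intro mult_left_mono) auto
  finally show ?thesis
    unfolding abel using mult_nonneg_nonneg[OF u b, of 0 0] mult_nonneg_nonneg[OF u b, of N "Suc N"]
    by linarith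
qed

section \<open>The Banach lattice of p-summable sequences\<close>

definition lp_tendsto ::
  "real \<Rightarrow> (nat \<Rightarrow> nat \<Rightarrow> 'a::{real_normed_field, banach}) \<Rightarrow> (nat \<Rightarrow> 'a) \<Rightarrow> bool" where
  "lp_tendsto p X x \<longleftrightarrow> (\<forall>k. X k \<in> lp p) \<and> x \<in> lp p \<and>
     (\<lambda>k::nat. lp_norm p (\<lambda>n. X k n - x n)) \<longlonglongrightarrow> 0"

locale lp_exponent =
  fixes p :: real
  assumes p: "1 \<le> p"
begin

lemma lp_summable: "x \<in> lp p \<Longrightarrow> summable (\<lambda>n. norm (x n) powr p)"
  by (simp add: lp_def)

lemma lp_norm_nonneg: "0 \<le> lp_norm p x"
  by (simp add: lp_norm_def)

lemma lp_norm_powr: "x \<in> lp p \<Longrightarrow> lp_norm p x powr p = (\<Sum>n. norm (x n) powr p)"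
  using p by (simp add: lp_norm_def powr_powr suminf_nonneg lp_summable)

lemma lp_norm_le_iff:
  assumes "x \<in> lp p" "0 \<le> C"
  shows "lp_norm p x \<le> C \<longleftrightarrow> (\<Sum>n. norm (x n) powr p) \<le> C powr p"
  using assms p powr_le_powr_iff[of p "lp_norm p x" C] lp_norm_nonneg[of x]
  by (simp flip: lp_norm_powr)

lemma lp_dominated:
  assumes "x \<in> lp p" "\<And>n. norm (y n) \<le> norm (x n)"
  shows "y \<in> lp p" "lp_norm p y \<le> lp_norm p x"
proof -
  have le: "norm (y n) powr p \<le> norm (x n) powr p" for n
    using assms(2) p by (intro powr_mono2) auto
  show y: "y \<in> lp p"
    using summable_comparison_test'[OF lp_summable[OF assms(1)], of 0 "\<lambda>n. norm (y n) powr p"] le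
    by (simp add: lp_def)
  have "(\<Sum>n. norm (y n) powr p) \<le> (\<Sum>n. norm (x n) powr p)"
    using assms(1) le y by (intro suminf_le lp_summable) auto
  then show "lp_norm p y \<le> lp_norm p x"
    unfolding lp_norm_def using p y by (intro powr_mono2 suminf_nonneg lp_summable) auto
qed

lemma lp_coordinate_le:
  assumes "x \<in> lp p"
  shows "norm (x i) \<le> lp_norm p x"
proof -
  have "(\<Sum>n\<in>{i}. norm (x n) powr p) \<le> (\<Sum>n. norm (x n) powr p)"
    using assms by (intro sum_le_suminf lp_summable) auto
  then have "norm (x i) powr p \<le> lp_norm p x powr p"
    using assms by (simp add: lp_norm_powr)
  then show ?thesis
    using p lp_norm_nonneg[of x] by (subst (asm) powr_le_powr_iff) auto
qed

lemma lp_finite_support: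
  assumes "\<And>n. N \<le> n \<Longrightarrow> x n = 0"
  shows "x \<in> lp p"
proof -
  have "summable (\<lambda>n. norm (x n) powr p)"
    using assms by (intro summable_finite[of "{..<N}"]) (auto simp: not_less)
  then show ?thesis by (simp add: lp_def)
qed

lemma lp_zero: "(\<lambda>n. 0) \<in> lp p" "lp_norm p (\<lambda>n. 0) = 0"
  by (auto simp: lp_def lp_norm_def)

lemma lp_unit_seq:
  "(unit_seq j :: nat \<Rightarrow> 'a::{real_normed_field, banach}) \<in> lp p"
  "lp_norm p (unit_seq j :: nat \<Rightarrow> 'a) = 1"
proof -
  show "(unit_seq j :: nat \<Rightarrow> 'a) \<in> lp p"
    by (rule lp_finite_support[of "Suc j"]) (auto simp: unit_seq_def)
  have "(\<lambda>n. norm (unit_seq j n :: 'a) powr p) = (\<lambda>n. if n = j then 1 else 0)"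
    using p by (auto simp: unit_seq_def)
  then show "lp_norm p (unit_seq j :: nat \<Rightarrow> 'a) = 1"
    using sums_single[of j "\<lambda>_. 1::real"] by (simp add: lp_norm_def sums_iff)
qed

lemma lp_scale:
  assumes "x \<in> lp p"
  shows "(\<lambda>n. c * x n) \<in> lp p" "lp_norm p (\<lambda>n. c * x n) = norm c * lp_norm p x"
proof -
  have eq: "norm (c * x n) powr p = norm c powr p * norm (x n) powr p" for n
    by (simp add: norm_mult powr_mult)
  show "(\<lambda>n. c * x n) \<in> lp p"
    using lp_summable[OF assms] unfolding lp_def by (simp add: eq summable_mult)
  show "lp_norm p (\<lambda>n. c * x n) = norm c * lp_norm p x"
    using lp_summable[OF assms] p
    by (simp add: lp_norm_def eq suminf_mult powr_mult powr_powr suminf_nonneg)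
qed

text \<open>
  Minkowski's inequality, with upper bounds \<open>a\<close> and \<open>b\<close> in place of the norms to keep the
  denominators positive. The sum is \<open>a + b\<close> times a convex combination of \<open>x / a\<close> and \<open>y / b\<close>.
\<close>

lemma lp_add_bound:
  assumes x: "x \<in> lp p" "lp_norm p x \<le> a" and y: "y \<in> lp p" "lp_norm p y \<le> b"
    and ab: "0 < a" "0 < b"
  shows "(\<lambda>n. x n + y n) \<in> lp p" "lp_norm p (\<lambda>n. x n + y n) \<le> a + b"
proof -
  define A B where "A = (a + b) powr p * (a / (a + b)) / a powr p"
    and "B = (a + b) powr p * (b / (a + b)) / b powr p"
  have weights: "a / (a + b) + b / (a + b) = 1" using ab by (subst add_divide_distrib[symmetric]) simp
  have AB: "0 \<le> A" "0 \<le> B" using ab by (auto simp: A_def B_def)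
  have bound: "norm (x n + y n) powr p \<le> A * norm (x n) powr p + B * norm (y n) powr p" for n
  proof -
    have "norm (x n + y n) powr p \<le> (norm (x n) + norm (y n)) powr p"
      using p by (intro powr_mono2 norm_triangle_ineq) auto
    also have "norm (x n) + norm (y n)
        = (a + b) * (a / (a + b) * (norm (x n) / a) + b / (a + b) * (norm (y n) / b))"
      using ab by (simp add: distrib_left)
    also have "\<dots> powr p = (a + b) powr p *
        (a / (a + b) * (norm (x n) / a) + b / (a + b) * (norm (y n) / b)) powr p"
      using ab by (subst powr_mult) auto
    also have "\<dots> \<le> (a + b) powr p *
        (a / (a + b) * (norm (x n) / a) powr p + b / (a + b) * (norm (y n) / b) powr p)"
      using ab p weights by (intro mult_left_mono powr_convex_combination) simp_all
    also have "\<dots> = A * norm (x n) powr p + B * norm (y n) powr p"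
      using ab by (simp add: A_def B_def powr_divide distrib_left)
    finally show ?thesis .
  qed
  have sm: "summable (\<lambda>n. A * norm (x n) powr p + B * norm (y n) powr p)"
    using x y by (intro summable_add summable_mult lp_summable)
  show xy: "(\<lambda>n. x n + y n) \<in> lp p"
    unfolding lp_def using bound summable_comparison_test'[OF sm, of 0 "\<lambda>n. norm (x n + y n) powr p"] by simp
  have "(\<Sum>n. norm (x n + y n) powr p) \<le> (\<Sum>n. A * norm (x n) powr p + B * norm (y n) powr p)"
    using bound sm lp_summable[OF xy] by (intro suminf_le) auto
  also have "\<dots> = A * (\<Sum>n. norm (x n) powr p) + B * (\<Sum>n. norm (y n) powr p)"
    using x y by (simp add: suminf_add[symmetric] suminf_mult summable_mult lp_summable)
  also have "\<dots> \<le> A * a powr p + B * b powr p"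
    using AB x y ab lp_norm_le_iff[of x a] lp_norm_le_iff[of y b]
    by (intro add_mono mult_left_mono) auto
  also have "\<dots> = (a + b) powr p * (a / (a + b)) + (a + b) powr p * (b / (a + b))"
    using ab by (simp add: A_def B_def)
  also have "\<dots> = (a + b) powr p"
    using weights by (metis distrib_left mult.right_neutral)
  finally have "(\<Sum>n. norm (x n + y n) powr p) \<le> (a + b) powr p" .
  moreover have "0 \<le> a + b" using ab by linarith
  ultimately show "lp_norm p (\<lambda>n. x n + y n) \<le> a + b"
    using lp_norm_le_iff[OF xy, of "a + b"] by blast
qed

lemma lp_add:
  assumes "x \<in> lp p" "y \<in> lp p"
  shows "(\<lambda>n. x n + y n) \<in> lp p" "lp_norm p (\<lambda>n. x n + y n) \<le> lp_norm p x + lp_norm p y"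
proof -
  have bounds: "(\<lambda>n. x n + y n) \<in> lp p
      \<and> lp_norm p (\<lambda>n. x n + y n) \<le> (lp_norm p x + e) + (lp_norm p y + e)" if "0 < e" for e
  proof -
    have le: "lp_norm p x \<le> lp_norm p x + e" "lp_norm p y \<le> lp_norm p y + e"
      using that by linarith+
    have pos: "0 < lp_norm p x + e" "0 < lp_norm p y + e"
      using that lp_norm_nonneg[of x] lp_norm_nonneg[of y] by linarith+
    show ?thesis
      using lp_add_bound[OF assms(1) le(1) assms(2) le(2) pos] by blast
  qed
  show "(\<lambda>n. x n + y n) \<in> lp p"
    using bounds[of 1] by linarith
  show "lp_norm p (\<lambda>n. x n + y n) \<le> lp_norm p x + lp_norm p y"
  proof (rule field_le_epsilon)
    fix e :: real assume "0 < e"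
    then show "lp_norm p (\<lambda>n. x n + y n) \<le> lp_norm p x + lp_norm p y + e"
      using bounds[of "e/2"] by linarith
  qed
qed

lemma lp_diff:
  assumes "x \<in> lp p" "y \<in> lp p"
  shows "(\<lambda>n. x n - y n) \<in> lp p" "lp_norm p (\<lambda>n. x n - y n) \<le> lp_norm p x + lp_norm p y"
proof -
  have "lp_norm p (\<lambda>n. - 1 * y n) = lp_norm p y"
    using lp_scale(2)[OF assms(2), of "- 1"] by (simp only: norm_minus_cancel norm_one mult_1)
  moreover have "(\<lambda>n. x n - y n) = (\<lambda>n. x n + - 1 * y n)"
    by (simp add: fun_eq_iff)
  ultimately show "(\<lambda>n. x n - y n) \<in> lp p"
    "lp_norm p (\<lambda>n. x n - y n) \<le> lp_norm p x + lp_norm p y"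
    using lp_add[OF assms(1) lp_scale(1)[OF assms(2), of "- 1"]] by (simp_all only:)
qed

lemma lp_norm_diff_commute: "lp_norm p (\<lambda>n. x n - y n) = lp_norm p (\<lambda>n. y n - x n)"
proof -
  have "(\<lambda>n. norm (x n - y n) powr p) = (\<lambda>n. norm (y n - x n) powr p)"
    by (rule ext) (subst norm_minus_commute, rule refl)
  then show ?thesis by (simp only: lp_norm_def)
qed

lemma lp_norm_diff_triangle:
  assumes "x \<in> lp p" "y \<in> lp p" "z \<in> lp p"
  shows "lp_norm p (\<lambda>n. x n - z n)
    \<le> lp_norm p (\<lambda>n. x n - y n) + lp_norm p (\<lambda>n. y n - z n)"
  using lp_add(2)[OF lp_diff(1)[OF assms(1,2)] lp_diff(1)[OF assms(2,3)]] by simp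

lemma lp_sum: "(\<And>k. k \<in> A \<Longrightarrow> X k \<in> lp p) \<Longrightarrow> (\<lambda>n. \<Sum>k\<in>A. X k n) \<in> lp p"
  by (induction A rule: infinite_finite_induct) (simp_all add: lp_zero(1) lp_add(1))

lemma lp_norm_eq_0:
  assumes "x \<in> lp p" "lp_norm p x = 0"
  shows "x = (\<lambda>n. 0)"
proof
  fix i
  show "x i = 0" using lp_coordinate_le[OF assms(1), of i] assms(2) by simp
qed

text \<open>
  Fatou's lemma for counting measure. It also supplies the membership of limits, so that
  completeness reduces to the convergence of coordinates.
\<close>

lemma lp_fatou:
  assumes X: "\<And>k. X k \<in> lp p" "\<forall>\<^sub>F k in sequentially. lp_norm p (X k) \<le> C"
    and lim: "\<And>n. (\<lambda>k. X k n) \<longlonglongrightarrow> x n"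
  shows "x \<in> lp p" "lp_norm p x \<le> C"
proof -
  obtain k where "lp_norm p (X k) \<le> C"
    using eventually_happens[OF X(2)] by auto
  then have "0 \<le> C" using lp_norm_nonneg[of "X k"] by linarith
  have part: "(\<Sum>n<N. norm (x n) powr p) \<le> C powr p" for N
  proof (rule tendsto_upperbound)
    show "(\<lambda>k. \<Sum>n<N. norm (X k n) powr p) \<longlonglongrightarrow> (\<Sum>n<N. norm (x n) powr p)"
      using p lim by (intro tendsto_sum tendsto_powr' tendsto_norm tendsto_const) auto
    show "\<forall>\<^sub>F k in sequentially. (\<Sum>n<N. norm (X k n) powr p) \<le> C powr p"
      using X(2)
    proof eventually_elim
      case (elim k)
      have "(\<Sum>n<N. norm (X k n) powr p) \<le> (\<Sum>n. norm (X k n) powr p)"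
        using X(1) by (intro sum_le_suminf lp_summable) auto
      also have "\<dots> \<le> C powr p"
        using elim X(1) \<open>0 \<le> C\<close> by (simp add: lp_norm_le_iff)
      finally show ?case .
    qed
  qed simp
  show "x \<in> lp p"
    unfolding lp_def using part by (simp add: summableI_nonneg_bounded[of _ "C powr p"])
  then show "lp_norm p x \<le> C"
    using part \<open>0 \<le> C\<close> by (auto simp: lp_norm_le_iff intro: suminf_le_const lp_summable)
qed

lemma lp_tendsto_coordinate:
  assumes "lp_tendsto p X x"
  shows "(\<lambda>k. X k i) \<longlonglongrightarrow> x i"
proof -
  have "(\<lambda>k. X k i - x i) \<longlonglongrightarrow> 0"
  proof (rule Lim_null_comparison)
    show "\<forall>\<^sub>F k in sequentially. norm (X k i - x i) \<le> lp_norm p (\<lambda>n. X k n - x n)"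
      using assms by (intro always_eventually allI lp_coordinate_le lp_diff) (auto simp: lp_tendsto_def)
  qed (use assms in \<open>simp add: lp_tendsto_def\<close>)
  then show ?thesis by (simp add: LIM_zero_iff)
qed

lemma lp_complete:
  assumes X: "\<And>k. X k \<in> lp p"
    and Cauchy: "\<And>e. 0 < e \<Longrightarrow> \<exists>N. \<forall>k\<ge>N. \<forall>l\<ge>N. lp_norm p (\<lambda>n. X k n - X l n) < e"
  obtains x where "lp_tendsto p X x"
proof -
  have "convergent (\<lambda>k. X k n)" for n
  proof (intro Cauchy_convergent CauchyI)
    fix e :: real assume "0 < e"
    with Cauchy obtain N where N: "\<forall>k\<ge>N. \<forall>l\<ge>N. lp_norm p (\<lambda>n. X k n - X l n) < e"
      by blast
    have "norm (X k n - X l n) < e" if "N \<le> k" "N \<le> l" for k l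
      using lp_coordinate_le[OF lp_diff(1)[OF X X], of k n l] N that by fastforce
    then show "\<exists>N. \<forall>k\<ge>N. \<forall>l\<ge>N. norm (X k n - X l n) < e" by blast
  qed
  then obtain x where x: "\<And>n. (\<lambda>k. X k n) \<longlonglongrightarrow> x n"
    unfolding convergent_def by metis
  have tail: "\<exists>N. \<forall>k\<ge>N. (\<lambda>n. X k n - x n) \<in> lp p \<and> lp_norm p (\<lambda>n. X k n - x n) \<le> e"
    if e: "0 < e" for e
  proof -
    obtain N where N: "\<forall>k\<ge>N. \<forall>l\<ge>N. lp_norm p (\<lambda>n. X k n - X l n) < e"
      using Cauchy[OF e] by blast
    have "(\<lambda>n. X k n - x n) \<in> lp p \<and> lp_norm p (\<lambda>n. X k n - x n) \<le> e" if "N \<le> k" for k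
    proof -
      have "\<forall>\<^sub>F l in sequentially. lp_norm p (\<lambda>n. X k n - X l n) \<le> e"
        using N that by (intro eventually_sequentiallyI[of N]) (auto intro: less_imp_le)
      moreover have "(\<lambda>l. X k n - X l n) \<longlonglongrightarrow> X k n - x n" for n
        by (intro tendsto_diff tendsto_const x)
      ultimately show ?thesis
        using lp_fatou[of "\<lambda>l n. X k n - X l n" e "\<lambda>n. X k n - x n"] lp_diff(1)[OF X X] by simp
    qed
    then show ?thesis by blast
  qed
  obtain N where "(\<lambda>n. X N n - x n) \<in> lp p" using tail[of 1] by auto
  from lp_diff(1)[OF X[of N] this] have "x \<in> lp p" by simp
  moreover have "(\<lambda>k. lp_norm p (\<lambda>n. X k n - x n)) \<longlonglongrightarrow> 0"
  proof (rule LIMSEQ_I)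
    fix e :: real assume "0 < e"
    then obtain N where N: "\<And>k. N \<le> k \<Longrightarrow> lp_norm p (\<lambda>n. X k n - x n) \<le> e / 2"
      using tail[of "e / 2"] by auto
    have "norm (lp_norm p (\<lambda>n. X k n - x n) - 0) < e" if "N \<le> k" for k
      using N[OF that] \<open>0 < e\<close> by (simp add: lp_norm_nonneg)
    then show "\<exists>N. \<forall>k\<ge>N. norm (lp_norm p (\<lambda>n. X k n - x n) - 0) < e"
      by blast
  qed
  ultimately show ?thesis using that X by (auto simp: lp_tendsto_def)
qed

text \<open>
  Finitely supported sequences are dense, so bounded operators are determined by their matrices.
\<close>

lemma lp_truncation_tendsto:
  assumes x: "x \<in> lp p"
  shows "lp_tendsto p (\<lambda>N n. if n < N then x n else 0) x"
proof -
  have mem: "(\<lambda>n. if n < N then x n else 0) \<in> lp p" for N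
    by (rule lp_finite_support[of N]) auto
  have norm_eq: "lp_norm p (\<lambda>n. (if n < N then x n else 0) - x n)
      = (\<Sum>n. norm (x (n + N)) powr p) powr (1 / p)" for N
  proof -
    have "(\<lambda>n. norm ((if n < N then x n else 0) - x n) powr p)
        = (\<lambda>n. if n < N then 0 else norm (x n) powr p)"
      by auto
    moreover from this have "summable (\<lambda>n. if n < N then 0 else norm (x n) powr p)"
      using lp_summable[OF lp_diff(1)[OF mem x], of N] by simp
    then have "(\<Sum>n. if n < N then 0 else norm (x n) powr p) = (\<Sum>n. norm (x (n + N)) powr p)"
      using suminf_split_initial_segment[of "\<lambda>n. if n < N then 0 else norm (x n) powr p" N]
      by simp
    ultimately show ?thesis by (simp add: lp_norm_def)
  qed
  have "(\<lambda>N. (\<Sum>n. norm (x (n + N)) powr p)) \<longlonglongrightarrow> 0"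
    using suminf_exist_split2[OF lp_summable[OF x]] .
  moreover have "0 \<le> (\<Sum>n. norm (x (n + N)) powr p)" for N
    using x by (intro suminf_nonneg summable_ignore_initial_segment lp_summable) auto
  ultimately have "(\<lambda>N. (\<Sum>n. norm (x (n + N)) powr p) powr (1 / p)) \<longlonglongrightarrow> 0 powr (1 / p)"
    using p by (intro tendsto_powr' tendsto_const) auto
  then show ?thesis
    using mem x by (simp add: lp_tendsto_def norm_eq)
qed

lemma lp_Metric_space: "Metric_space (lp p) (\<lambda>x y. lp_norm p (\<lambda>n. x n - y n))"
proof
  fix x y z :: "nat \<Rightarrow> 'b::{real_normed_field,banach}"
  show "0 \<le> lp_norm p (\<lambda>n. x n - y n)" by (rule lp_norm_nonneg)
  show "lp_norm p (\<lambda>n. x n - y n) = lp_norm p (\<lambda>n. y n - x n)" by (rule lp_norm_diff_commute)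
  show "lp_norm p (\<lambda>n. x n - y n) = 0 \<longleftrightarrow> x = y" if "x \<in> lp p" "y \<in> lp p"
    using lp_norm_eq_0[OF lp_diff(1)[OF that]] by (auto simp: lp_zero fun_eq_iff)
  show "lp_norm p (\<lambda>n. x n - z n) \<le> lp_norm p (\<lambda>n. x n - y n) + lp_norm p (\<lambda>n. y n - z n)"
    if "x \<in> lp p" "y \<in> lp p" "z \<in> lp p"
    using that by (rule lp_norm_diff_triangle)
qed

lemma lp_limitin_iff:
  assumes "\<And>k. X k \<in> lp p"
  shows "limitin (lp_topology p) X x sequentially \<longleftrightarrow> lp_tendsto p X x"
proof -
  interpret Metric_space "lp p :: (nat \<Rightarrow> 'a::{real_normed_field,banach}) set"
    "\<lambda>x y. lp_norm p (\<lambda>n. x n - y n)"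
    by (rule lp_Metric_space)
  show ?thesis
    using assms lp_norm_nonneg unfolding lp_topology_def limitin_metric lp_tendsto_def tendsto_iff
    by (simp add: lp_norm_nonneg)
qed

text \<open>
  Norm convergence implies convergence of coordinates, so sets given by closed conditions on
  coordinates are closed. Both kinds of subspaces that occur below are of this form.
\<close>

lemma lp_closedin_pointwise:
  assumes "V \<subseteq> lp p"
    and "\<And>X x. (\<And>k. X k \<in> V) \<Longrightarrow> x \<in> lp p \<Longrightarrow> (\<And>i. (\<lambda>k::nat. X k i) \<longlonglongrightarrow> x i) \<Longrightarrow> x \<in> V"
  shows "closedin (lp_topology p) V"
proof -
  interpret Metric_space "lp p :: (nat \<Rightarrow> 'a::{real_normed_field,banach}) set"
    "\<lambda>x y. lp_norm p (\<lambda>n. x n - y n)"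
    by (rule lp_Metric_space)
  have "x \<in> V" if "range X \<subseteq> V" "limitin (lp_topology p) X x sequentially" for X x
  proof -
    have "lp_tendsto p X x" using that lp_limitin_iff[of X x] assms(1) by blast
    then show ?thesis
      using assms(2)[of X x] that lp_tendsto_coordinate by (auto simp: lp_tendsto_def)
  qed
  then show ?thesis
    using assms(1) unfolding lp_topology_def metric_closedin_iff_sequentially_closed by blast
qed

section \<open>Bounded operators and their powers\<close>

lemma lp_operatorD:
  assumes "lp_operator p T" "x \<in> lp p"
  shows "T x \<in> lp p" "y \<in> lp p \<Longrightarrow> T (\<lambda>n. x n + y n) = (\<lambda>n. T x n + T y n)"
    "T (\<lambda>n. c * x n) = (\<lambda>n. c * T x n)"
  using assms by (auto simp: lp_operator_def)

lemma lp_operator_zero: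
  assumes "lp_operator p T"
  shows "T (\<lambda>n. 0) = (\<lambda>n. 0)"
  using lp_operatorD(3)[OF assms lp_zero(1), of 0] by simp

lemma lp_operator_diff:
  assumes "lp_operator p T" "x \<in> lp p" "y \<in> lp p"
  shows "T (\<lambda>n. x n - y n) = (\<lambda>n. T x n - T y n)"
  using lp_operatorD(2)[OF assms(1,2) lp_scale(1)[OF assms(3), of "- 1"]]
    lp_operatorD(3)[OF assms(1,3), of "- 1"]
  by simp

lemma lp_operator_sum:
  assumes "lp_operator p T" "\<And>k. k \<in> A \<Longrightarrow> X k \<in> lp p"
  shows "T (\<lambda>n. \<Sum>k\<in>A. X k n) = (\<lambda>n. \<Sum>k\<in>A. T (X k) n)"
  using assms(2)
proof (induction A rule: infinite_finite_induct)
  case (insert a A)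
  then show ?case
    using lp_operatorD(2)[OF assms(1), of "X a" "\<lambda>n. \<Sum>k\<in>A. X k n"] lp_sum[of A X]
    by simp
qed (simp_all add: lp_operator_zero[OF assms(1)])

lemma lp_opnorm_upper:
  assumes T: "lp_operator p T" and x: "x \<in> lp_unit_ball p"
  shows "lp_norm p (T x) \<le> lp_opnorm p T"
proof -
  obtain C where C: "\<And>x. x \<in> lp p \<Longrightarrow> lp_norm p (T x) \<le> C * lp_norm p x"
    using T unfolding lp_operator_def by blast
  have "bdd_above ((\<lambda>x. lp_norm p (T x)) ` lp_unit_ball p)"
  proof (rule bdd_aboveI2)
    fix x :: "nat \<Rightarrow> 'a" assume x: "x \<in> lp_unit_ball p"
    have "lp_norm p (T x) \<le> C * lp_norm p x" using C x by (simp add: lp_unit_ball_def)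
    also have "\<dots> \<le> \<bar>C\<bar> * lp_norm p x" by (intro mult_right_mono lp_norm_nonneg) simp
    also have "\<dots> \<le> \<bar>C\<bar> * 1" using x by (intro mult_left_mono) (auto simp: lp_unit_ball_def)
    finally show "lp_norm p (T x) \<le> \<bar>C\<bar> * 1" .
  qed
  then show ?thesis unfolding lp_opnorm_def using x by (intro cSUP_upper)
qed

lemma lp_zero_in_unit_ball: "(\<lambda>n. 0) \<in> lp_unit_ball p"
  by (simp add: lp_unit_ball_def lp_zero)

lemma lp_opnorm_nonneg: "lp_operator p T \<Longrightarrow> 0 \<le> lp_opnorm p T"
  using lp_opnorm_upper[OF _ lp_zero_in_unit_ball] lp_norm_nonneg order_trans by blast

lemma lp_opnorm_bound:
  assumes T: "lp_operator p T" and x: "x \<in> lp p"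
  shows "lp_norm p (T x) \<le> lp_opnorm p T * lp_norm p x"
proof (cases "lp_norm p x = 0")
  case True
  then have "x = (\<lambda>n. 0)" using lp_norm_eq_0[OF x] by blast
  then show ?thesis using lp_operator_zero[OF T] by (simp add: lp_zero)
next
  case False
  then have pos: "0 < lp_norm p x" using lp_norm_nonneg[of x] by linarith
  \<comment> \<open>The norm is tested on unit vectors only; other vectors are rescaled.\<close>
  define c where "c = (of_real (1 / lp_norm p x) :: 'a)"
  have c: "norm c = 1 / lp_norm p x" using pos unfolding c_def norm_of_real by simp
  have "(\<lambda>n. c * x n) \<in> lp_unit_ball p"
    using lp_scale[OF x, of c] c pos by (simp add: lp_unit_ball_def)
  from lp_opnorm_upper[OF T this]
  have "norm c * lp_norm p (T x) \<le> lp_opnorm p T"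
    using lp_operatorD(3)[OF T x, of c] lp_scale(2)[OF lp_operatorD(1)[OF T x], of c] by simp
  then show ?thesis using pos by (simp add: c field_simps)
qed

lemma lp_opnorm_least:
  assumes "\<And>x. x \<in> lp_unit_ball p \<Longrightarrow> lp_norm p (T x) \<le> C"
  shows "lp_opnorm p T \<le> C"
  unfolding lp_opnorm_def using assms lp_zero_in_unit_ball by (intro cSUP_least) auto

lemma lp_operator_compose:
  assumes T: "lp_operator p T" and U: "lp_operator p U"
  shows "lp_operator p (T \<circ> U)"
proof -
  have "lp_norm p (T (U x)) \<le> lp_opnorm p T * lp_opnorm p U * lp_norm p x" if "x \<in> lp p" for x
  proof -
    have "lp_norm p (T (U x)) \<le> lp_opnorm p T * lp_norm p (U x)"
      using lp_opnorm_bound[OF T lp_operatorD(1)[OF U that]] .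
    also have "\<dots> \<le> lp_opnorm p T * (lp_opnorm p U * lp_norm p x)"
      by (intro mult_left_mono lp_opnorm_bound U that lp_opnorm_nonneg T)
    finally show ?thesis by (simp add: mult.assoc)
  qed
  then have "\<exists>C. \<forall>x\<in>lp p. lp_norm p ((T \<circ> U) x) \<le> C * lp_norm p x"
    by auto
  moreover have "(T \<circ> U) x \<in> lp p" if "x \<in> lp p" for x
    using lp_operatorD(1)[OF T lp_operatorD(1)[OF U that]] by simp
  moreover have "(T \<circ> U) (\<lambda>n. x n + y n) = (\<lambda>n. (T \<circ> U) x n + (T \<circ> U) y n)"
    if "x \<in> lp p" "y \<in> lp p" for x y
    using that lp_operatorD(1,2)[OF U] lp_operatorD(2)[OF T] by simp
  moreover have "(T \<circ> U) (\<lambda>n. c * x n) = (\<lambda>n. c * (T \<circ> U) x n)" if "x \<in> lp p" for x c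
    using that lp_operatorD(1,3)[OF U] lp_operatorD(3)[OF T] by simp
  ultimately show ?thesis unfolding lp_operator_def by blast
qed

lemma lp_operator_funpow:
  assumes "lp_operator p T"
  shows "lp_operator p (T ^^ n)"
proof (induction n)
  case 0
  have "\<exists>C. \<forall>x\<in>lp p. lp_norm p (id x) \<le> C * lp_norm p (x :: nat \<Rightarrow> 'a)"
    by (intro exI[of _ 1]) simp
  then show ?case by (simp add: lp_operator_def)
next
  case (Suc n)
  then show ?case using lp_operator_compose[OF assms] by (simp only: funpow.simps)
qed

lemma lp_opnorm_funpow_add:
  assumes T: "lp_operator p T"
  shows "lp_opnorm p (T ^^ (m + n)) \<le> lp_opnorm p (T ^^ m) * lp_opnorm p (T ^^ n)"
proof (rule lp_opnorm_least)
  fix x :: "nat \<Rightarrow> 'a" assume x: "x \<in> lp_unit_ball p"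
  then have xl: "x \<in> lp p" by (simp add: lp_unit_ball_def)
  note Tn = lp_operator_funpow[OF T]
  have "lp_norm p ((T ^^ m) ((T ^^ n) x)) \<le> lp_opnorm p (T ^^ m) * lp_norm p ((T ^^ n) x)"
    using lp_opnorm_bound[OF Tn lp_operatorD(1)[OF Tn xl]] .
  also have "\<dots> \<le> lp_opnorm p (T ^^ m) * lp_opnorm p (T ^^ n)"
    by (intro mult_left_mono lp_opnorm_upper Tn x lp_opnorm_nonneg)
  finally show "lp_norm p ((T ^^ (m + n)) x) \<le> lp_opnorm p (T ^^ m) * lp_opnorm p (T ^^ n)"
    by (simp add: funpow_add)
qed

text \<open>
  The norms of the powers are submultiplicative, so the limit in the definition of the spectral
  radius exists and is the infimum of the roots.
\<close>

lemma
  assumes T: "lp_operator p T"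
  shows spectral_radius_limit: "(\<lambda>n. root n (lp_opnorm p (T ^^ n))) \<longlonglongrightarrow> spectral_radius p T"
    and spectral_radius_nonneg: "0 \<le> spectral_radius p T"
    and spectral_radius_power_le: "0 < n \<Longrightarrow> spectral_radius p T ^ n \<le> lp_opnorm p (T ^^ n)"
proof -
  obtain L where L: "(\<lambda>n. root n (lp_opnorm p (T ^^ n))) \<longlonglongrightarrow> L" "0 \<le> L"
    "\<And>n. 0 < n \<Longrightarrow> L ^ n \<le> lp_opnorm p (T ^^ n)"
    using submultiplicative_root_limit[of "\<lambda>n. lp_opnorm p (T ^^ n)",
        OF lp_opnorm_nonneg[OF lp_operator_funpow[OF T]] lp_opnorm_funpow_add[OF T]] by metis
  moreover from L(1) have "spectral_radius p T = L"
    unfolding spectral_radius_def by (rule limI)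
  ultimately show "(\<lambda>n. root n (lp_opnorm p (T ^^ n))) \<longlonglongrightarrow> spectral_radius p T"
    "0 \<le> spectral_radius p T" "0 < n \<Longrightarrow> spectral_radius p T ^ n \<le> lp_opnorm p (T ^^ n)"
    by simp_all
qed

lemma lp_opnorm_funpow_small:
  assumes T: "lp_operator p T" and q: "spectral_radius p T < q"
  obtains m where "0 < m" "lp_opnorm p (T ^^ m) \<le> q ^ m"
proof -
  have "\<forall>\<^sub>F m in sequentially. root m (lp_opnorm p (T ^^ m)) < q \<and> 0 < m"
    using order_tendstoD(2)[OF spectral_radius_limit[OF T] q] eventually_gt_at_top[of 0]
    by (rule eventually_conj)
  then obtain m where m: "root m (lp_opnorm p (T ^^ m)) < q" "0 < m"
    using eventually_happens by fastforce
  have "root m (lp_opnorm p (T ^^ m)) ^ m \<le> q ^ m"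
    using m lp_opnorm_nonneg[OF lp_operator_funpow[OF T]] by (intro power_mono) auto
  then show ?thesis
    using m that lp_opnorm_nonneg[OF lp_operator_funpow[OF T]] by simp
qed

lemma lp_opnorm_funpow_growth:
  assumes T: "lp_operator p T" and q: "spectral_radius p T < q"
  obtains C where "0 < C" "\<And>n. lp_opnorm p (T ^^ n) \<le> C * q ^ n"
proof -
  obtain m where m: "0 < m" "lp_opnorm p (T ^^ m) \<le> q ^ m"
    using lp_opnorm_funpow_small[OF assms] .
  have "0 < q" using spectral_radius_nonneg[OF T] q by linarith
  then show ?thesis
    using submultiplicative_growth[of "\<lambda>n. lp_opnorm p (T ^^ n)" m q,
        OF lp_opnorm_nonneg[OF lp_operator_funpow[OF T]] lp_opnorm_funpow_add[OF T]] m that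
    by blast
qed

lemma lp_operator_tendsto:
  assumes T: "lp_operator p T" and X: "lp_tendsto p X x"
  shows "lp_tendsto p (\<lambda>k. T (X k)) (T x)"
proof -
  have mem: "X k \<in> lp p" "x \<in> lp p" for k using X by (auto simp: lp_tendsto_def)
  have "lp_norm p (\<lambda>n. T (X k) n - T x n) \<le> lp_opnorm p T * lp_norm p (\<lambda>n. X k n - x n)" for k
    using lp_opnorm_bound[OF T lp_diff(1)[OF mem]] lp_operator_diff[OF T mem] by simp
  then have le: "\<forall>\<^sub>F k in sequentially. norm (lp_norm p (\<lambda>n. T (X k) n - T x n))
      \<le> lp_opnorm p T * lp_norm p (\<lambda>n. X k n - x n)"
    by (intro always_eventually allI) (simp only: real_norm_def abs_of_nonneg lp_norm_nonneg)
  have "(\<lambda>k. lp_norm p (\<lambda>n. X k n - x n)) \<longlonglongrightarrow> 0"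
    using X unfolding lp_tendsto_def by blast
  from Lim_null_comparison[OF le tendsto_mult_right_zero[OF this]]
  have "(\<lambda>k. lp_norm p (\<lambda>n. T (X k) n - T x n)) \<longlonglongrightarrow> 0" .
  then show ?thesis using mem lp_operatorD(1)[OF T] by (simp add: lp_tendsto_def)
qed

lemma lp_operator_matrix_sums:
  assumes T: "lp_operator p T" and x: "x \<in> lp p"
  shows "(\<lambda>j. x j * T (unit_seq j) i) sums T x i"
proof -
  have "T (\<lambda>n. if n < N then x n else 0) i = (\<Sum>j<N. x j * T (unit_seq j) i)" for N
  proof -
    have "(\<lambda>n. if n < N then x n else 0) = (\<lambda>n. \<Sum>j<N. x j * unit_seq j n)"
      by (simp add: unit_seq_def fun_eq_iff if_distrib cong: if_cong)
    moreover have "T (\<lambda>n. \<Sum>j<N. x j * unit_seq j n) = (\<lambda>n. \<Sum>j<N. T (\<lambda>n. x j * unit_seq j n) n)"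
      by (intro lp_operator_sum T lp_scale lp_unit_seq)
    ultimately show ?thesis
      using lp_operatorD(3)[OF T lp_unit_seq(1)] by simp
  qed
  then show ?thesis
    using lp_tendsto_coordinate[OF lp_operator_tendsto[OF T lp_truncation_tendsto[OF x]], of i]
    by (simp add: sums_def)
qed

section \<open>Positive operators\<close>

lemma lp_posD: "x \<in> lp_pos p \<Longrightarrow> x \<in> lp p" "x \<in> lp_pos p \<Longrightarrow> x n \<in> \<real>\<^sub>\<ge>\<^sub>0"
  by (auto simp: lp_pos_def)

lemma unit_seq_pos: "unit_seq j \<in> lp_pos p"
  using lp_unit_seq(1) by (auto simp: lp_pos_def unit_seq_def)

lemma lp_pos_scale: "x \<in> lp_pos p \<Longrightarrow> c \<in> \<real>\<^sub>\<ge>\<^sub>0 \<Longrightarrow> (\<lambda>n. c * x n) \<in> lp_pos p"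
  by (simp add: lp_pos_def lp_scale)

lemma lp_positive_funpow: "lp_positive p T \<Longrightarrow> lp_positive p (T ^^ n)"
  by (induction n) (auto simp: lp_positive_def)

text \<open>
  For positive \<open>x\<close> the contributions of the single coordinates of \<open>x\<close> cannot cancel, so each of
  them is a lower bound. Applied to the powers of \<open>T\<close>, this gives the lower bounds for products of
  entries along paths in the graph of \<open>T\<close>.
\<close>

lemma lp_positive_entry_le:
  assumes T: "lp_operator p T" "lp_positive p T" and x: "x \<in> lp_pos p"
  shows "norm (x j) * norm (T (unit_seq j) i) \<le> norm (T x i)"
proof -
  have xj: "(\<lambda>n. x j * unit_seq j n) \<in> lp_pos p"
    using x by (intro lp_pos_scale unit_seq_pos) (simp add: lp_posD)
  have "(\<lambda>n. x n - x j * unit_seq j n) \<in> lp_pos p"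
    using x lp_diff(1)[OF lp_posD(1)[OF x] lp_posD(1)[OF xj]]
    by (auto simp: lp_pos_def unit_seq_def)
  then have "T x i - T (\<lambda>n. x j * unit_seq j n) i \<in> \<real>\<^sub>\<ge>\<^sub>0"
    using T(2) lp_operator_diff[OF T(1) lp_posD(1)[OF x] lp_posD(1)[OF xj]]
    by (fastforce simp: lp_positive_def lp_pos_def)
  moreover have "T (\<lambda>n. x j * unit_seq j n) i \<in> \<real>\<^sub>\<ge>\<^sub>0"
    using T(2) xj by (auto simp: lp_positive_def lp_pos_def)
  ultimately have "norm (T (\<lambda>n. x j * unit_seq j n) i) \<le> norm (T x i)"
    by (rule nonneg_Reals_norm_mono[rotated])
  then show ?thesis
    using lp_operatorD(3)[OF T(1) lp_unit_seq(1), of "x j"] by (simp add: norm_mult)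
qed

lemma lp_abs:
  fixes x :: "nat \<Rightarrow> 'a::{real_normed_field, banach}"
  assumes "x \<in> lp p"
  shows "(\<lambda>n. of_real (norm (x n)) :: 'a) \<in> lp_pos p"
    "lp_norm p (\<lambda>n. of_real (norm (x n)) :: 'a) = lp_norm p x"
  using assms by (simp_all add: lp_pos_def lp_def lp_norm_def)

text \<open>
  The matrix of \<open>T\<close> has nonnegative entries, so this is the triangle inequality for the series
  that defines a coordinate of \<open>T x\<close>.
\<close>

lemma lp_positive_abs_le:
  assumes T: "lp_operator p T" "lp_positive p T" and x: "x \<in> lp p"
  shows "norm (T x i) \<le> norm (T (\<lambda>n. of_real (norm (x n))) i)"
proof (rule LIMSEQ_le)
  let ?t = "\<lambda>j. T (unit_seq j) i"
  let ?a = "\<lambda>n. of_real (norm (x n))"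
  have "T (unit_seq j) \<in> lp_pos p" for j
    using T(2) unit_seq_pos[of j] unfolding lp_positive_def by blast
  then have t: "?t j = of_real (norm (?t j))" for j
    using lp_posD(2) nonneg_Reals_iff_norm by blast
  show "(\<lambda>N. norm (\<Sum>j<N. x j * ?t j)) \<longlonglongrightarrow> norm (T x i)"
    using lp_operator_matrix_sums[OF T(1) x, of i] by (intro tendsto_norm) (simp add: sums_def)
  show "(\<lambda>N. norm (\<Sum>j<N. ?a j * ?t j)) \<longlonglongrightarrow> norm (T ?a i)"
    using lp_operator_matrix_sums[OF T(1) lp_posD(1)[OF lp_abs(1)[OF x]], of i]
    by (intro tendsto_norm) (simp add: sums_def)
  have "norm (\<Sum>j<N. x j * ?t j) \<le> norm (\<Sum>j<N. ?a j * ?t j)" for N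
  proof -
    have "?a j * ?t j = of_real (norm (x j) * norm (?t j))" for j
      by (subst t) simp
    then have "(\<Sum>j<N. ?a j * ?t j) = of_real (\<Sum>j<N. norm (x j) * norm (?t j))"
      by (simp only: of_real_sum)
    moreover have "0 \<le> (\<Sum>j<N. norm (x j) * norm (?t j))"
      by (intro sum_nonneg) simp
    ultimately have "norm (\<Sum>j<N. ?a j * ?t j) = (\<Sum>j<N. norm (x j * ?t j))"
      by (simp only: norm_of_real abs_of_nonneg norm_mult)
    then show ?thesis using norm_sum[of "\<lambda>j. x j * ?t j" "{..<N}"] by simp
  qed
  then show "\<exists>N. \<forall>n\<ge>N. norm (\<Sum>j<n. x j * ?t j) \<le> norm (\<Sum>j<n. ?a j * ?t j)" by blast
qed

text \<open>
  Replacing a vector by its modulus keeps its norm and does not decrease that of its image.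
\<close>

lemma lp_positive_almost_norming:
  assumes T: "lp_operator p T" "lp_positive p T" and c: "c < lp_opnorm p T"
  obtains x where "x \<in> lp_pos p" "lp_norm p x \<le> 1" "c < lp_norm p (T x)"
proof -
  obtain z where z: "z \<in> lp_unit_ball p" "c < lp_norm p (T z)"
    using c lp_opnorm_least[of T c] by (meson not_le)
  define x where "x = (\<lambda>n. of_real (norm (z n)) :: 'a)"
  have zl: "z \<in> lp p" using z by (simp add: lp_unit_ball_def)
  have x: "x \<in> lp_pos p" "lp_norm p x \<le> 1"
    using lp_abs[OF zl] z by (simp_all add: x_def lp_unit_ball_def)
  have "lp_norm p (T z) \<le> lp_norm p (T x)"
    using lp_positive_abs_le[OF T zl] lp_operatorD(1)[OF T(1) lp_posD(1)[OF x(1)]]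
    unfolding x_def by (intro lp_dominated(2)) simp_all
  then show ?thesis using x z that by fastforce
qed

section \<open>Irreducible positive matrices\<close>

text \<open>
  Index sets that are closed under the nonzero entries of the matrix give invariant ideals. This
  turns the absence of invariant ideals into a statement about the graph of the matrix.
\<close>

lemma invariant_ideal_support:
  fixes S :: "'a::{real_normed_field, banach} seq_op"
  assumes S: "lp_operator p S" and A: "A \<noteq> {}" "A \<noteq> UNIV"
    and inv: "\<And>i j. j \<in> A \<Longrightarrow> i \<notin> A \<Longrightarrow> S (unit_seq j) i = 0"
  shows "invariant_ideal p S {x \<in> lp p. \<forall>i. i \<notin> A \<longrightarrow> x i = 0}" (is "invariant_ideal p S ?V")
proof -
  obtain i j where i: "i \<in> A" and j: "j \<notin> A" using A by blast
  have "closedin (lp_topology p) ?V"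
  proof (rule lp_closedin_pointwise)
    fix X and x :: "nat \<Rightarrow> 'a"
    assume X: "\<And>k. X k \<in> ?V" and x: "x \<in> lp p" "\<And>i. (\<lambda>k::nat. X k i) \<longlonglongrightarrow> x i"
    have "x i = 0" if "i \<notin> A" for i
      using LIMSEQ_unique[OF x(2)[of i], of 0] X that by simp
    then show "x \<in> ?V" using x by simp
  qed simp
  then have "lp_closed_subspace p ?V"
    by (simp add: lp_closed_subspace_def lp_zero lp_add lp_scale subset_eq)
  moreover have "S ` ?V \<subseteq> ?V"
  proof clarify
    fix x assume x: "x \<in> lp p" "\<forall>i. i \<notin> A \<longrightarrow> x i = (0::'a)"
    have "S x i = 0" if "i \<notin> A" for i
    proof -
      have "x j * S (unit_seq j) i = 0" for j using x(2) inv[of j i] that by auto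
      then have "(\<lambda>j. 0) sums S x i"
        using lp_operator_matrix_sums[OF S x(1), of i] by (simp only:)
      then show ?thesis using sums_unique2 sums_zero by blast
    qed
    then show "S x \<in> lp p \<and> (\<forall>i. i \<notin> A \<longrightarrow> S x i = 0)"
      using lp_operatorD(1)[OF S x(1)] by simp
  qed
  moreover have "?V \<noteq> {\<lambda>n. 0}"
  proof -
    have "unit_seq i \<in> ?V" using lp_unit_seq(1) i by (auto simp: unit_seq_def)
    moreover have "unit_seq i \<noteq> (\<lambda>n. 0 :: 'a)" by (auto simp: unit_seq_def fun_eq_iff)
    ultimately show ?thesis by blast
  qed
  moreover have "?V \<noteq> lp p"
  proof -
    have "unit_seq j \<notin> ?V" using j by (auto simp: unit_seq_def)
    then show ?thesis using lp_unit_seq(1)[of j] by blast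
  qed
  moreover have "lp_solid p ?V"
    unfolding lp_solid_def by (auto; metis norm_le_zero_iff norm_zero)
  ultimately show ?thesis by (simp add: invariant_ideal_def invariant_subspace_def)
qed

text \<open>
  The indices that can be reached from \<open>j\<close> in at least one step form a closed set \<open>A\<close>. If \<open>j\<close> were
  not among them, \<open>A\<close> would have to be empty; but then \<open>{j}\<close> would be a closed set.
\<close>

lemma irreducible_cycle:
  assumes T: "lp_operator p T" "lp_positive p T"
    and irred: "\<And>A. A \<noteq> {} \<Longrightarrow> A \<noteq> UNIV \<Longrightarrow> \<exists>j\<in>A. \<exists>i. i \<notin> A \<and> T (unit_seq j) i \<noteq> 0"
  obtains n where "0 < n" "(T ^^ n) (unit_seq j) j \<noteq> 0"
proof -
  define A where "A = {i. \<exists>n>0. (T ^^ n) (unit_seq j) i \<noteq> 0}"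
  have invA: "i \<in> A" if k: "k \<in> A" and ki: "T (unit_seq k) i \<noteq> 0" for k i
  proof -
    obtain n where n: "0 < n" "(T ^^ n) (unit_seq j) k \<noteq> 0" using k by (auto simp: A_def)
    have "(T ^^ n) (unit_seq j) \<in> lp_pos p"
      using lp_positive_funpow[OF T(2)] unit_seq_pos unfolding lp_positive_def by blast
    from lp_positive_entry_le[OF T this, of k i]
    have "norm ((T ^^ n) (unit_seq j) k) * norm (T (unit_seq k) i)
        \<le> norm ((T ^^ Suc n) (unit_seq j) i)"
      by simp
    moreover have "0 < norm ((T ^^ n) (unit_seq j) k) * norm (T (unit_seq k) i)"
      using n ki by simp
    ultimately have "(T ^^ Suc n) (unit_seq j) i \<noteq> 0" by (metis norm_zero not_less)
    then show ?thesis unfolding A_def by blast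
  qed
  have "j \<in> A"
  proof (rule ccontr)
    assume "j \<notin> A"
    then have "A = {}" using irred[of A] invA by blast
    then have "(T ^^ Suc 0) (unit_seq j) i = 0" for i
      unfolding A_def by blast
    then have "T (unit_seq j) i = 0" for i
      by simp
    moreover have "{j} \<noteq> UNIV"
      by (metis UNIV_I n_not_Suc_n singletonD)
    ultimately show False using irred[of "{j}"] by blast
  qed
  then show ?thesis using that unfolding A_def by blast
qed

text \<open>
  If \<open>a\<close> is the diagonal entry of \<open>T ^^ n\<close>, going round the cycle \<open>k\<close> times contributes \<open>a ^ k\<close> to
  the diagonal entry of \<open>T ^^ (n * k)\<close>, which is incompatible with a spectral radius smaller than
  the \<open>n\<close>-th root of \<open>a / 2\<close>.
\<close>

lemma spectral_radius_pos_of_cycle: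
  assumes T: "lp_operator p T" "lp_positive p T"
    and n: "0 < n" "(T ^^ n) (unit_seq j) j \<noteq> 0"
  shows "0 < spectral_radius p T"
proof (rule ccontr)
  assume "\<not> 0 < spectral_radius p T"
  define a where "a = norm ((T ^^ n) (unit_seq j) j)"
  have a: "0 < a" using n by (simp add: a_def)
  note Tk = lp_operator_funpow[OF T(1)] lp_positive_funpow[OF T(2)]
  have lower: "a ^ k \<le> norm ((T ^^ (n * k)) (unit_seq j) j)" for k
  proof (induction k)
    case 0
    show ?case by (simp add: unit_seq_def)
  next
    case (Suc k)
    have "(T ^^ (n * k)) (unit_seq j) \<in> lp_pos p"
      using Tk(2) unit_seq_pos unfolding lp_positive_def by blast
    from lp_positive_entry_le[OF Tk[of n] this, of j j]
    have "norm ((T ^^ (n * k)) (unit_seq j) j) * a \<le> norm ((T ^^ (n * Suc k)) (unit_seq j) j)"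
      by (simp add: a_def funpow_add)
    moreover have "a ^ Suc k \<le> norm ((T ^^ (n * k)) (unit_seq j) j) * a"
      using mult_right_mono[OF Suc, of a] a by (simp add: mult.commute)
    ultimately show ?case by linarith
  qed
  define q where "q = root n (a / 2)"
  have q: "0 < q" "q ^ n = a / 2" using a n by (simp_all add: q_def)
  then have "spectral_radius p T < q" using \<open>\<not> 0 < spectral_radius p T\<close> by linarith
  then obtain C where C: "0 < C" "\<And>k. lp_opnorm p (T ^^ k) \<le> C * q ^ k"
    using lp_opnorm_funpow_growth[OF T(1)] by blast
  obtain k where k: "C < 2 ^ k" using real_arch_pow[of 2 C] by auto
  have "a ^ k \<le> lp_norm p ((T ^^ (n * k)) (unit_seq j))"
    using lower[of k] lp_coordinate_le[OF lp_operatorD(1)[OF Tk(1) lp_unit_seq(1)]]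
    by (rule order_trans)
  also have "\<dots> \<le> lp_opnorm p (T ^^ (n * k))"
    using lp_opnorm_bound[OF Tk(1) lp_unit_seq(1), of "n * k" j] by (simp add: lp_unit_seq)
  also have "\<dots> \<le> C * (a / 2) ^ k" using C(2)[of "n * k"] by (simp add: power_mult q)
  also have "\<dots> < 2 ^ k * (a / 2) ^ k" using k a by (intro mult_strict_right_mono) auto
  also have "\<dots> = a ^ k" by (simp flip: power_mult_distrib)
  finally show False by simp
qed

section \<open>Positive approximate eigenvectors at the spectral radius\<close>

text \<open>
  The vectors \<open>b k = r ^ (- k) * T ^^ k x\<close> satisfy \<open>T (b k) = r * b (k + 1)\<close>, so a sum of the \<open>b k\<close>
  with slowly varying weights is almost fixed by \<open>T / r\<close>. The weights form a tent
  \<open>(1 + d) ^ (- \<bar>k - m\<bar>)\<close> whose peak is at an index \<open>m\<close> where \<open>b m\<close> is not small; such \<open>x\<close> and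
  \<open>m\<close> exist because the norm of \<open>T ^^ m\<close> is at least \<open>r ^ m\<close>. At \<open>k = 0\<close> the tent is negligible
  if \<open>m\<close> is large, and at the far end \<open>N\<close> it decays faster than \<open>b\<close> can grow.
\<close>

lemma approximate_eigenvector:
  fixes T :: "'a::{real_normed_field, banach} seq_op"
  defines "r \<equiv> spectral_radius p T"
  assumes T: "lp_operator p T" "lp_positive p T" and r: "0 < r" and e: "0 < e"
  obtains v where "v \<in> lp_pos p" "lp_norm p v = 1"
    "lp_norm p (\<lambda>i. of_real r * v i - T v i) \<le> e"
proof -
  \<comment> \<open>The error will be at most r times d times (norm of the sum + 2), and the norm of the sum
    exceeds 1 / 2; this accounts for the factor 5.\<close>
  define d where "d = e / (5 * r)"
  have d: "0 < d" using e r by (simp add: d_def)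
  obtain m where m0: "max (1 / d) 1 < (1 + d) ^ m"
    using real_arch_pow[of "1 + d" "max (1 / d) 1"] d by auto
  then have "0 < m" by (cases m) auto
  have "r ^ m / 2 < lp_opnorm p (T ^^ m)"
    using spectral_radius_power_le[OF T(1) \<open>0 < m\<close>] zero_less_power[OF r, of m]
    unfolding r_def[symmetric] by linarith
  then obtain x where x: "x \<in> lp_pos p" "lp_norm p x \<le> 1"
      "r ^ m / 2 < lp_norm p ((T ^^ m) x)"
    using lp_positive_almost_norming[OF lp_operator_funpow[OF T(1)] lp_positive_funpow[OF T(2)]]
    by metis
  then have m: "1 / d < (1 + d) ^ m" "r ^ m / 2 < lp_norm p ((T ^^ m) x)"
    using m0 by simp_all
  define b where "b k = (\<lambda>i. of_real (1 / r ^ k) * (T ^^ k) x i)" for k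
  have powx: "(T ^^ k) x \<in> lp_pos p" for k
    using lp_positive_funpow[OF T(2)] x(1) unfolding lp_positive_def by blast
  have b: "b k \<in> lp_pos p" for k
    unfolding b_def using powx r by (intro lp_pos_scale) simp_all
  have bl: "b k \<in> lp p" for k using b by (simp add: lp_posD)
  have norm_b: "lp_norm p (b k) = lp_norm p ((T ^^ k) x) / r ^ k" for k
  proof -
    have "norm (of_real (1 / r ^ k) :: 'a) = 1 / r ^ k"
      using r unfolding norm_of_real by simp
    then show ?thesis
      unfolding b_def lp_scale(2)[OF lp_posD(1)[OF powx]] by simp
  qed
  have Tb: "T (b k) = (\<lambda>i. of_real r * b (Suc k) i)" for k
    unfolding b_def lp_operatorD(3)[OF T(1) lp_posD(1)[OF powx]] using r
    by (simp add: fun_eq_iff)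
  define u where "u k = (if k \<le> m then 1 / (1 + d) ^ (m - k) else 1 / (1 + d) ^ (k - m))" for k
  have u_pos: "0 < u k" for k using d by (simp add: u_def)
  have u_m: "u m = 1" by (simp add: u_def)
  have u_var: "\<bar>u (Suc k) - u k\<bar> \<le> d * u (Suc k)" for k
  proof (cases "k < m")
    case True
    then have "m - k = Suc (m - Suc k)" by simp
    then have "u k * (1 + d) = u (Suc k)" using True d by (simp add: u_def)
    then have "u (Suc k) - u k = d * u k" by (simp add: algebra_simps)
    moreover have "u k \<le> u (Suc k)"
      using calculation mult_pos_pos[OF d u_pos, of k] by linarith
    ultimately show ?thesis using d u_pos[of k] by simp
  next
    case False
    then have "Suc k - m = Suc (k - m)" by simp
    then have "u (Suc k) * (1 + d) = u k" using False d by (auto simp: u_def)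
    then have "u k - u (Suc k) = d * u (Suc k)" by (simp add: algebra_simps)
    then show ?thesis using mult_pos_pos[OF d u_pos, of "Suc k"] by linarith
  qed
  \<comment> \<open>A growth rate strictly between r and r * (1 + d), so that the weights win beyond the peak.\<close>
  have "r < r * (1 + d / 2)" using r d by simp
  then obtain C where C: "0 < C" "\<And>k. lp_opnorm p (T ^^ k) \<le> C * (r * (1 + d / 2)) ^ k"
    using lp_opnorm_funpow_growth[OF T(1)] unfolding r_def by blast
  have "(\<lambda>N. C * (1 + d / 2) * (1 + d) ^ m * ((1 + d / 2) / (1 + d)) ^ N)
      \<longlonglongrightarrow> C * (1 + d / 2) * (1 + d) ^ m * 0"
    using d by (intro tendsto_mult tendsto_const LIMSEQ_power_zero) simp_all
  then have "\<forall>\<^sub>F N in sequentially.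
      C * (1 + d / 2) * (1 + d) ^ m * ((1 + d / 2) / (1 + d)) ^ N < d \<and> m < N"
    using d by (intro eventually_conj order_tendstoD(2) eventually_gt_at_top) simp_all
  then obtain N where N: "C * (1 + d / 2) * (1 + d) ^ m * ((1 + d / 2) / (1 + d)) ^ N < d" "m < N"
    using eventually_happens by fastforce
  have tail: "u N * lp_norm p (b (Suc N)) \<le> d"
  proof -
    have "lp_norm p ((T ^^ Suc N) x) \<le> lp_opnorm p (T ^^ Suc N) * 1"
      using lp_opnorm_bound[OF lp_operator_funpow[OF T(1)] lp_posD(1)[OF x(1)], of "Suc N"]
        mult_left_mono[OF x(2) lp_opnorm_nonneg[OF lp_operator_funpow[OF T(1), of "Suc N"]]]
      by linarith
    also have "\<dots> \<le> C * (r * (1 + d / 2)) ^ Suc N" using C(2)[of "Suc N"] by linarith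
    also have "\<dots> = C * (1 + d / 2) ^ Suc N * r ^ Suc N"
      by (simp only: power_mult_distrib mult_ac)
    finally have "lp_norm p (b (Suc N)) \<le> C * (1 + d / 2) ^ Suc N"
      unfolding norm_b using r by (simp only: pos_divide_le_eq zero_less_power)
    then have "u N * lp_norm p (b (Suc N)) \<le> u N * (C * (1 + d / 2) ^ Suc N)"
      using u_pos[of N] by (intro mult_left_mono) auto
    moreover have "u N = (1 + d) ^ m / (1 + d) ^ N"
      using N(2) d by (simp add: u_def power_diff)
    moreover have "(1 + d) ^ m / (1 + d) ^ N * (C * (1 + d / 2) ^ Suc N)
        = C * (1 + d / 2) * (1 + d) ^ m * ((1 + d / 2) / (1 + d)) ^ N"
      by (simp add: power_divide)
    ultimately show ?thesis using N(1) by (simp only:)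
  qed
  have head: "u 0 * lp_norm p (b 0) \<le> d"
  proof -
    have "1 / (1 + d) ^ m \<le> d" using m(1) d by (simp add: field_simps)
    then have "u 0 \<le> d" by (simp add: u_def)
    moreover have "lp_norm p (b 0) \<le> 1" using x(2) by (simp add: norm_b)
    ultimately have "u 0 * lp_norm p (b 0) \<le> d * 1"
      using u_pos[of 0] d lp_norm_nonneg by (intro mult_mono) auto
    then show ?thesis by simp
  qed
  define y where "y = (\<lambda>i. \<Sum>k\<le>N. of_real (u k) * b k i)"
  have ul: "(\<lambda>i. of_real (u k) * b k i) \<in> lp p" for k using lp_scale[OF bl] by blast
  have yl: "y \<in> lp p" unfolding y_def by (rule lp_sum[OF ul])
  define \<beta> where "\<beta> i k = norm (b k i)" for i k
  have b_eq: "b k i = of_real (\<beta> i k)" for k i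
    using b[of k] nonneg_Reals_iff_norm lp_posD(2) unfolding \<beta>_def by blast
  have y_eq: "y i = of_real (\<Sum>k\<le>N. u k * \<beta> i k)" for i
    unfolding y_def b_eq by simp
  have y_sum_nonneg: "0 \<le> (\<Sum>k\<le>N. u k * \<beta> i k)" for i
    using u_pos by (intro sum_nonneg mult_nonneg_nonneg) (auto simp: \<beta>_def less_imp_le)
  have "y i \<in> \<real>\<^sub>\<ge>\<^sub>0" for i
    unfolding y_eq nonneg_Reals_of_real_iff by (rule y_sum_nonneg)
  then have y: "y \<in> lp_pos p" using yl unfolding lp_pos_def by blast
  have norm_y: "1 / 2 < lp_norm p y"
  proof -
    have "norm (b m i) \<le> norm (y i)" for i
    proof -
      have "u m * \<beta> i m \<le> (\<Sum>k\<le>N. u k * \<beta> i k)"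
        using N(2) u_pos by (intro member_le_sum mult_nonneg_nonneg) (auto simp: \<beta>_def less_imp_le)
      then show ?thesis
        unfolding y_eq norm_of_real using u_m by (simp add: \<beta>_def)
    qed
    then have "lp_norm p (b m) \<le> lp_norm p y" by (rule lp_dominated(2)[OF yl])
    moreover have "1 / 2 < lp_norm p (b m)"
      unfolding norm_b using m(2) r by (simp add: less_divide_eq)
    ultimately show ?thesis by linarith
  qed
  have Ty: "T y i = of_real (\<Sum>k\<le>N. u k * (r * \<beta> i (Suc k)))" for i
  proof -
    have "T y = (\<lambda>i. \<Sum>k\<le>N. T (\<lambda>i. of_real (u k) * b k i) i)"
      unfolding y_def by (rule lp_operator_sum[OF T(1) ul])
    also have "\<dots> = (\<lambda>i. \<Sum>k\<le>N. of_real (u k) * (of_real r * b (Suc k) i))"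
      by (simp add: lp_operatorD(3)[OF T(1) bl] Tb)
    finally show ?thesis by (simp add: b_eq)
  qed
  \<comment> \<open>The right-hand side of the telescoping bound, as a vector that dominates the error.\<close>
  define z where "z = (\<lambda>i. of_real (u 0) * b 0 i + (of_real d * y i + of_real (u N) * b (Suc N) i))"
  have parts: "(\<lambda>i. of_real (u 0) * b 0 i) \<in> lp p" "(\<lambda>i. of_real d * y i) \<in> lp p"
    "(\<lambda>i. of_real (u N) * b (Suc N) i) \<in> lp p"
    by (intro lp_scale bl yl)+
  have zl: "z \<in> lp p" unfolding z_def by (intro lp_add parts)
  have "lp_norm p z \<le> u 0 * lp_norm p (b 0) + (d * lp_norm p y + u N * lp_norm p (b (Suc N)))"
  proof -
    have "lp_norm p z \<le> lp_norm p (\<lambda>i. of_real (u 0) * b 0 i)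
        + (lp_norm p (\<lambda>i. of_real d * y i) + lp_norm p (\<lambda>i. of_real (u N) * b (Suc N) i))"
      unfolding z_def
      using lp_add(2)[OF parts(1) lp_add(1)[OF parts(2,3)]] lp_add(2)[OF parts(2,3)]
      by linarith
    then show ?thesis
      using lp_scale(2)[OF bl] lp_scale(2)[OF yl] u_pos[of 0] u_pos[of N] d by simp
  qed
  also have "\<dots> \<le> 5 * d * lp_norm p y"
  proof -
    have "d * (1 / 2) \<le> d * lp_norm p y" using norm_y d by (intro mult_left_mono) auto
    with head tail show ?thesis by linarith
  qed
  finally have norm_z: "lp_norm p z \<le> 5 * d * lp_norm p y" .
  have z_eq: "norm (z i) = u 0 * \<beta> i 0 + d * (\<Sum>k\<le>N. u k * \<beta> i k) + u N * \<beta> i (Suc N)" for i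
  proof -
    have "z i = of_real (u 0 * \<beta> i 0 + d * (\<Sum>k\<le>N. u k * \<beta> i k) + u N * \<beta> i (Suc N))"
      unfolding z_def y_eq b_eq by simp
    moreover have "0 \<le> u 0 * \<beta> i 0 + d * (\<Sum>k\<le>N. u k * \<beta> i k) + u N * \<beta> i (Suc N)"
      using u_pos[of 0] u_pos[of N] d y_sum_nonneg[of i] by (simp add: \<beta>_def)
    ultimately show ?thesis by (simp only: norm_of_real abs_of_nonneg)
  qed
  have dom: "norm (of_real r * y i - T y i) \<le> norm (of_real r * z i)" for i
  proof -
    have "of_real r * y i - T y i = of_real (r * (\<Sum>k\<le>N. u k * (\<beta> i k - \<beta> i (Suc k))))"
      unfolding y_eq Ty
      by (simp add: sum_distrib_left right_diff_distrib sum_subtractf mult.left_commute)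
    then have "norm (of_real r * y i - T y i) = r * \<bar>\<Sum>k\<le>N. u k * (\<beta> i k - \<beta> i (Suc k))\<bar>"
      using r by (simp only: norm_of_real abs_mult abs_of_pos)
    also have "\<dots> \<le> r * norm (z i)"
      unfolding z_eq using r u_pos d
      by (intro mult_left_mono weighted_telescope_bound u_var) (auto simp: \<beta>_def less_imp_le)
    finally show ?thesis using r by (simp add: norm_mult)
  qed
  have "lp_norm p (\<lambda>i. of_real r * y i - T y i) \<le> lp_norm p (\<lambda>i. of_real r * z i)"
    by (rule lp_dominated(2)[OF lp_scale(1)[OF zl] dom])
  also have "\<dots> \<le> r * (5 * d * lp_norm p y)"
    using lp_scale(2)[OF zl] r norm_z by (simp add: mult_left_mono)
  also have "\<dots> = e * lp_norm p y" using r by (simp add: d_def)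
  finally have res: "lp_norm p (\<lambda>i. of_real r * y i - T y i) \<le> e * lp_norm p y" .
  define c where "c = 1 / lp_norm p y"
  have c: "0 < c" "c * lp_norm p y = 1" using norm_y by (auto simp: c_def)
  define v where "v = (\<lambda>i. of_real c * y i)"
  have "v \<in> lp_pos p" unfolding v_def using c y by (intro lp_pos_scale) auto
  moreover have "lp_norm p v = 1" unfolding v_def using lp_scale(2)[OF yl] c by simp
  moreover have "lp_norm p (\<lambda>i. of_real r * v i - T v i) \<le> e"
  proof -
    have "(\<lambda>i. of_real r * v i - T v i) = (\<lambda>i. of_real c * (of_real r * y i - T y i))"
      unfolding v_def lp_operatorD(3)[OF T(1) yl] by (simp add: algebra_simps)
    then have "lp_norm p (\<lambda>i. of_real r * v i - T v i)
        = c * lp_norm p (\<lambda>i. of_real r * y i - T y i)"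
      using lp_scale(2)[OF lp_diff(1)[OF lp_scale(1)[OF yl] lp_operatorD(1)[OF T(1) yl]]] c
      by simp
    also have "\<dots> \<le> c * (e * lp_norm p y)" using res c by (intro mult_left_mono) auto
    also have "\<dots> = e" using c by (simp add: mult.left_commute)
    finally show ?thesis .
  qed
  ultimately show ?thesis using that by blast
qed

section \<open>Compact perturbations\<close>

text \<open>
  \<open>r - S\<close> is a right factor of \<open>r ^ m - S ^^ m\<close>; the constant is a norm bound for the cofactor,
  built up with \<open>r ^ Suc m - S ^^ Suc m = r * (r ^ m - S ^^ m) + S ^^ m * (r - S)\<close>.
\<close>

lemma lp_power_difference_bound:
  fixes S :: "'a::{real_normed_field, banach} seq_op"
  assumes S: "lp_operator p S" and r: "0 \<le> r"
  shows "\<exists>C\<ge>0. \<forall>x\<in>lp p. lp_norm p (\<lambda>i. of_real (r ^ m) * x i - (S ^^ m) x i)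
    \<le> C * lp_norm p (\<lambda>i. of_real r * x i - S x i)"
proof (induction m)
  case 0
  show ?case by (auto intro!: exI[of _ 0] simp: lp_zero)
next
  case (Suc m)
  then obtain C where C: "0 \<le> C" "\<And>x. x \<in> lp p \<Longrightarrow>
      lp_norm p (\<lambda>i. of_real (r ^ m) * x i - (S ^^ m) x i)
        \<le> C * lp_norm p (\<lambda>i. of_real r * x i - S x i)"
    by blast
  define D where "D = lp_opnorm p (S ^^ m)"
  note Sm = lp_operator_funpow[OF S, of m]
  have "lp_norm p (\<lambda>i. of_real (r ^ Suc m) * x i - (S ^^ Suc m) x i)
      \<le> (r * C + D) * lp_norm p (\<lambda>i. of_real r * x i - S x i)" if x: "x \<in> lp p" for x
  proof -
    let ?w = "\<lambda>i. of_real r * x i - S x i"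
    let ?z = "\<lambda>i. of_real (r ^ m) * x i - (S ^^ m) x i"
    have rx: "(\<lambda>i. of_real r * x i) \<in> lp p" and Sx: "S x \<in> lp p"
      using lp_scale(1)[OF x] lp_operatorD(1)[OF S x] by blast+
    have w: "?w \<in> lp p" by (rule lp_diff(1)[OF rx Sx])
    have z: "?z \<in> lp p" by (intro lp_diff(1) lp_scale(1) x lp_operatorD(1)[OF Sm])
    have "(S ^^ m) ?w = (\<lambda>i. of_real r * (S ^^ m) x i - (S ^^ Suc m) x i)"
      unfolding lp_operator_diff[OF Sm rx Sx] lp_operatorD(3)[OF Sm x] funpow_Suc_right by simp
    then have "(\<lambda>i. of_real (r ^ Suc m) * x i - (S ^^ Suc m) x i)
        = (\<lambda>i. of_real r * ?z i + (S ^^ m) ?w i)"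
      by (simp only:) (simp add: algebra_simps)
    then have "lp_norm p (\<lambda>i. of_real (r ^ Suc m) * x i - (S ^^ Suc m) x i)
        \<le> lp_norm p (\<lambda>i. of_real r * ?z i) + lp_norm p ((S ^^ m) ?w)"
      using lp_add(2)[OF lp_scale(1)[OF z] lp_operatorD(1)[OF Sm w]] by (simp only:)
    also have "lp_norm p (\<lambda>i. of_real r * ?z i) = r * lp_norm p ?z"
      using lp_scale(2)[OF z, of "of_real r"] r by simp
    also have "r * lp_norm p ?z \<le> r * (C * lp_norm p ?w)"
      using C(2)[OF x] r by (rule mult_left_mono)
    also have "lp_norm p ((S ^^ m) ?w) \<le> D * lp_norm p ?w"
      unfolding D_def by (rule lp_opnorm_bound[OF Sm w])
    finally show ?thesis by (simp add: distrib_right mult.assoc)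
  qed
  moreover have "0 \<le> r * C + D" unfolding D_def using r C(1) lp_opnorm_nonneg[OF Sm] by simp
  ultimately show ?case by blast
qed

text \<open>
  Some power of \<open>S\<close> has norm less than \<open>r ^ m\<close>, so \<open>r ^ m - S ^^ m\<close> is bounded below, and hence so
  is its factor \<open>r - S\<close>.
\<close>

lemma lp_bounded_below_outside_spectrum:
  fixes S :: "'a::{real_normed_field, banach} seq_op"
  assumes S: "lp_operator p S" and r: "spectral_radius p S < r"
  obtains C where "0 < C"
    "\<And>x. x \<in> lp p \<Longrightarrow> lp_norm p x \<le> C * lp_norm p (\<lambda>i. of_real r * x i - S x i)"
proof -
  obtain q where q: "spectral_radius p S < q" "q < r" using dense[OF r] by blast
  have q0: "0 < q" using spectral_radius_nonneg[OF S] q by linarith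
  obtain m where m: "0 < m" "lp_opnorm p (S ^^ m) \<le> q ^ m"
    using lp_opnorm_funpow_small[OF S q(1)] .
  note Sm = lp_operator_funpow[OF S, of m]
  have gap: "0 < r ^ m - q ^ m" using power_strict_mono[of q r m] q q0 m by simp
  have "0 \<le> r" using q q0 by linarith
  from lp_power_difference_bound[OF S this, of m]
  obtain C where C: "0 \<le> C" "\<And>x. x \<in> lp p \<Longrightarrow>
      lp_norm p (\<lambda>i. of_real (r ^ m) * x i - (S ^^ m) x i)
        \<le> C * lp_norm p (\<lambda>i. of_real r * x i - S x i)"
    by blast
  have "lp_norm p x \<le> (C + 1) / (r ^ m - q ^ m) * lp_norm p (\<lambda>i. of_real r * x i - S x i)"
    if x: "x \<in> lp p" for x
  proof -
    let ?w = "\<lambda>i. of_real r * x i - S x i"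
    let ?z = "\<lambda>i. of_real (r ^ m) * x i - (S ^^ m) x i"
    have z: "?z \<in> lp p" by (intro lp_diff(1) lp_scale(1) x lp_operatorD(1)[OF Sm])
    have "r ^ m * lp_norm p x = lp_norm p (\<lambda>i. of_real (r ^ m) * x i)"
      using lp_scale(2)[OF x, of "of_real (r ^ m)"] \<open>0 \<le> r\<close> unfolding norm_of_real by simp
    also have "(\<lambda>i. of_real (r ^ m) * x i) = (\<lambda>i. ?z i + (S ^^ m) x i)" by simp
    also have "lp_norm p \<dots> \<le> lp_norm p ?z + lp_norm p ((S ^^ m) x)"
      by (rule lp_add(2)[OF z lp_operatorD(1)[OF Sm x]])
    also have "lp_norm p ?z \<le> C * lp_norm p ?w" by (rule C(2)[OF x])
    also have "lp_norm p ((S ^^ m) x) \<le> lp_opnorm p (S ^^ m) * lp_norm p x"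
      by (rule lp_opnorm_bound[OF Sm x])
    also have "\<dots> \<le> q ^ m * lp_norm p x"
      by (rule mult_right_mono[OF m(2) lp_norm_nonneg])
    finally have "(r ^ m - q ^ m) * lp_norm p x \<le> C * lp_norm p ?w"
      by (simp add: left_diff_distrib)
    also have "\<dots> \<le> (C + 1) * lp_norm p ?w"
      by (intro mult_right_mono lp_norm_nonneg) simp
    finally show ?thesis using gap by (simp add: pos_le_divide_eq mult.commute)
  qed
  moreover have "0 < (C + 1) / (r ^ m - q ^ m)" using C(1) gap by simp
  ultimately show ?thesis using that by blast
qed

lemma lp_compact_op_subsequence:
  assumes K: "lp_compact_op p K" "\<And>x. x \<in> lp_unit_ball p \<Longrightarrow> K x \<in> lp p"
    and X: "\<And>k. X k \<in> lp_unit_ball p"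
  obtains w s where "strict_mono (s :: nat \<Rightarrow> nat)" "lp_tendsto p (\<lambda>k. K (X (s k))) w"
proof -
  interpret Metric_space "lp p :: (nat \<Rightarrow> 'a::{real_normed_field,banach}) set"
    "\<lambda>x y. lp_norm p (\<lambda>n. x n - y n)"
    by (rule lp_Metric_space)
  have "K ` lp_unit_ball p \<subseteq> topspace (lp_topology p)"
    using K(2) by (auto simp: lp_topology_def)
  then have "range (\<lambda>k. K (X k)) \<subseteq> lp_topology p closure_of (K ` lp_unit_ball p)"
    using closure_of_subset[of "K ` lp_unit_ball p" "lp_topology p"] X by blast
  then obtain w s where s: "strict_mono s"
      "limitin (lp_topology p) ((\<lambda>k. K (X k)) \<circ> s) w sequentially"
    using K(1) unfolding lp_compact_op_def lp_topology_def compactin_sequentially by meson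
  then have "lp_tendsto p (\<lambda>k. K (X (s k))) w"
    using lp_limitin_iff[of "\<lambda>k. K (X (s k))" w] K(2) X by (simp add: comp_def)
  with s(1) show ?thesis using that by blast
qed

text \<open>
  A Krein-Rutman theorem. The gap between the two spectral radii and the compactness of \<open>K\<close>
  imply that the essential spectral radius of \<open>T\<close> is less than \<open>r\<close>.
\<close>

lemma positive_eigenvector_of_compact_perturbation:
  fixes S T K :: "'a::{real_normed_field, banach} seq_op"
  defines "r \<equiv> spectral_radius p T"
  assumes S: "lp_operator p S" and T: "lp_operator p T" "lp_positive p T"
    and gap: "spectral_radius p S < r"
    and K: "lp_compact_op p K" "\<And>x. x \<in> lp p \<Longrightarrow> K x \<in> lp p"
    and TSK: "\<And>x i. x \<in> lp p \<Longrightarrow> T x i = S x i + c * K x i"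
  obtains v where "v \<in> lp_pos p" "v \<noteq> (\<lambda>n. 0)" "T v = (\<lambda>n. of_real r * v n)"
proof -
  have r: "0 < r" using spectral_radius_nonneg[OF S] gap by linarith
  have "\<exists>v. v \<in> lp_pos p \<and> lp_norm p v = 1
      \<and> lp_norm p (\<lambda>i. of_real r * v i - T v i) \<le> 1 / real (Suc k)" for k
    using approximate_eigenvector[OF T, of "1 / real (Suc k)"] r unfolding r_def
    by (metis of_nat_0_less_iff zero_less_Suc zero_less_divide_1_iff)
  then obtain X where X: "\<And>k. X k \<in> lp_pos p" "\<And>k. lp_norm p (X k) = 1"
      "\<And>k. lp_norm p (\<lambda>i. of_real r * X k i - T (X k) i) \<le> 1 / real (Suc k)"
    by metis
  have Xl: "X k \<in> lp p" for k using X(1) by (rule lp_posD(1))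
  have ball: "X k \<in> lp_unit_ball p" for k using X(2) Xl by (simp add: lp_unit_ball_def)
  have Kball: "K x \<in> lp p" if "x \<in> lp_unit_ball p" for x
    using K(2) that by (simp add: lp_unit_ball_def)
  obtain w s where s: "strict_mono (s :: nat \<Rightarrow> nat)" and w: "lp_tendsto p (\<lambda>k. K (X (s k))) w"
    using lp_compact_op_subsequence[OF K(1) Kball ball] .
  define Y where "Y k = X (s k)" for k
  have Yl: "Y k \<in> lp p" for k unfolding Y_def by (rule Xl)
  define g where "g k = (\<lambda>i. of_real r * Y k i - T (Y k) i)" for k
  have gl: "g k \<in> lp p" for k
    unfolding g_def by (intro lp_diff(1) lp_scale(1) Yl lp_operatorD(1)[OF T(1)])
  have g_bound: "lp_norm p (g k) \<le> 1 / real (Suc k)" for k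
  proof -
    have "lp_norm p (g k) \<le> 1 / real (Suc (s k))" unfolding g_def Y_def by (rule X(3))
    also have "\<dots> \<le> 1 / real (Suc k)"
      using seq_suble[OF s, of k] by (intro divide_left_mono) auto
    finally show ?thesis .
  qed
  have g_lim: "(\<lambda>k. lp_norm p (g k)) \<longlonglongrightarrow> 0"
    using g_bound
    by (intro Lim_null_comparison[OF _ LIMSEQ_inverse_real_of_nat] always_eventually allI)
      (simp only: inverse_eq_divide real_norm_def abs_of_nonneg lp_norm_nonneg)
  define h where "h k = lp_norm p (\<lambda>n. K (Y k) n - w n)" for k
  have h_lim: "h \<longlonglongrightarrow> 0" using w unfolding h_def Y_def lp_tendsto_def by blast
  have wl: "w \<in> lp p" using w unfolding lp_tendsto_def by blast
  obtain C where C: "0 < C"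
      "\<And>x. x \<in> lp p \<Longrightarrow> lp_norm p x \<le> C * lp_norm p (\<lambda>i. of_real r * x i - S x i)"
    using lp_bounded_below_outside_spectrum[OF S gap] by blast
  \<comment> \<open>(r - S) (Y k) differs from the fixed vector c * w by g k + c * (K (Y k) - w), and the lower
    bound for r - S turns this into a bound for the distance between members of the sequence Y.\<close>
  define E where "E k = C * (lp_norm p (g k) + norm c * h k)" for k
  have E_lim: "E \<longlonglongrightarrow> 0"
    unfolding E_def using tendsto_mult_right_zero[OF tendsto_add_zero[OF g_lim tendsto_mult_right_zero[OF h_lim]]] .
  have diff_bound: "lp_norm p (\<lambda>n. Y k n - Y l n) \<le> E k + E l" for k l
  proof -
    let ?x = "\<lambda>n. Y k n - Y l n"
    let ?a = "\<lambda>n. K (Y k) n - w n" and ?b = "\<lambda>n. K (Y l) n - w n"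
    have al: "?a \<in> lp p" "?b \<in> lp p" by (intro lp_diff(1) K(2) Yl wl)+
    have "(\<lambda>i. of_real r * ?x i - S ?x i) = (\<lambda>i. (g k i - g l i) + c * (?a i - ?b i))"
      unfolding g_def TSK[OF Yl] lp_operator_diff[OF S Yl Yl] by (simp add: algebra_simps)
    then have "lp_norm p (\<lambda>i. of_real r * ?x i - S ?x i)
        \<le> lp_norm p (\<lambda>i. g k i - g l i) + lp_norm p (\<lambda>i. c * (?a i - ?b i))"
      using lp_add(2)[OF lp_diff(1)[OF gl gl] lp_scale(1)[OF lp_diff(1)[OF al]]] by (simp only:)
    also have "lp_norm p (\<lambda>i. g k i - g l i) \<le> lp_norm p (g k) + lp_norm p (g l)"
      by (rule lp_diff(2)[OF gl gl])
    also have "lp_norm p (\<lambda>i. c * (?a i - ?b i)) = norm c * lp_norm p (\<lambda>i. ?a i - ?b i)"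
      by (rule lp_scale(2)[OF lp_diff(1)[OF al]])
    also have "\<dots> \<le> norm c * (h k + h l)"
      unfolding h_def by (intro mult_left_mono lp_diff(2)[OF al]) simp
    finally have "C * lp_norm p (\<lambda>i. of_real r * ?x i - S ?x i)
        \<le> C * (lp_norm p (g k) + lp_norm p (g l) + norm c * (h k + h l))"
      using C(1) by (intro mult_left_mono) simp_all
    moreover have "lp_norm p ?x \<le> C * lp_norm p (\<lambda>i. of_real r * ?x i - S ?x i)"
      by (rule C(2)[OF lp_diff(1)[OF Yl Yl]])
    ultimately show ?thesis unfolding E_def by (simp add: algebra_simps)
  qed
  have Cauchy: "\<exists>N. \<forall>k\<ge>N. \<forall>l\<ge>N. lp_norm p (\<lambda>n. Y k n - Y l n) < e" if "0 < e" for e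
  proof -
    have "\<forall>\<^sub>F k in sequentially. E k < e / 2" using that by (intro order_tendstoD(2)[OF E_lim]) simp
    then obtain N where N: "\<And>k. N \<le> k \<Longrightarrow> E k < e / 2"
      unfolding eventually_sequentially by blast
    have "lp_norm p (\<lambda>n. Y k n - Y l n) < e" if "N \<le> k" "N \<le> l" for k l
      using diff_bound[of k l] N[OF that(1)] N[OF that(2)] by linarith
    then show ?thesis by blast
  qed
  obtain v where v: "lp_tendsto p Y v" using lp_complete[of Y, OF Yl Cauchy] .
  have vl: "v \<in> lp p" using v unfolding lp_tendsto_def by blast
  have "v i \<in> \<real>\<^sub>\<ge>\<^sub>0" for i
    using nonneg_Reals_limit[OF lp_tendsto_coordinate[OF v]] X(1) lp_posD(2)
    unfolding Y_def by blast
  then have v_pos: "v \<in> lp_pos p" using vl unfolding lp_pos_def by blast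
  have "v \<noteq> (\<lambda>n. 0)"
  proof
    assume "v = (\<lambda>n. 0)"
    then have "(\<lambda>k. lp_norm p (Y k)) \<longlonglongrightarrow> 0" using v unfolding lp_tendsto_def by simp
    moreover have "(\<lambda>k. lp_norm p (Y k)) = (\<lambda>k. 1)" using X(2) unfolding Y_def by simp
    ultimately show False using LIMSEQ_unique[OF _ tendsto_const[of "1::real"]] by fastforce
  qed
  moreover have "T v i = of_real r * v i" for i
  proof -
    have "(\<lambda>k. g k i) \<longlonglongrightarrow> 0"
      using lp_coordinate_le[OF gl] by (intro Lim_null_comparison[OF _ g_lim] always_eventually) blast
    moreover have "(\<lambda>k. g k i) \<longlonglongrightarrow> of_real r * v i - T v i"
      unfolding g_def
      by (intro tendsto_diff tendsto_mult tendsto_const lp_tendsto_coordinate[OF v]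
          lp_tendsto_coordinate[OF lp_operator_tendsto[OF T(1) v]])
    ultimately show ?thesis using LIMSEQ_unique by fastforce
  qed
  ultimately show ?thesis using that[OF v_pos] by blast
qed

section \<open>The modulus\<close>

lemma lp_modulus_upper:
  fixes S M :: "'a::{real_normed_field, banach} seq_op"
  assumes "lp_modulus p S M" "x \<in> lp_pos p"
  shows "M x i - S x i \<in> \<real>\<^sub>\<ge>\<^sub>0" "M x i + S x i \<in> \<real>\<^sub>\<ge>\<^sub>0"
  using assms by (auto simp: lp_modulus_def lp_op_le_def lp_positive_def lp_pos_def)

lemma lp_modulus_positive:
  fixes S M :: "'a::{real_normed_field, banach} seq_op"
  assumes "lp_modulus p S M"
  shows "lp_positive p M"
  unfolding lp_positive_def
proof
  fix x :: "nat \<Rightarrow> 'a" assume x: "x \<in> lp_pos p"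
  have M: "lp_operator p M" using assms by (simp add: lp_modulus_def)
  have "M x i \<in> \<real>\<^sub>\<ge>\<^sub>0" for i
  proof -
    have "((M x i - S x i) + (M x i + S x i)) / 2 \<in> \<real>\<^sub>\<ge>\<^sub>0"
      by (intro nonneg_Reals_divide_I nonneg_Reals_add_I lp_modulus_upper[OF assms x]) simp
    then show ?thesis by simp
  qed
  then show "M x \<in> lp_pos p"
    using lp_operatorD(1)[OF M lp_posD(1)[OF x]] by (simp add: lp_pos_def)
qed

text \<open>
  This carries the irreducibility of \<open>S\<close> over to its modulus.
\<close>

lemma lp_modulus_entry_zero:
  fixes S M :: "'a::{real_normed_field, banach} seq_op"
  assumes "lp_modulus p S M" "M (unit_seq j) i = 0"
  shows "S (unit_seq j) i = 0"
proof -
  have "0 - S (unit_seq j) i \<in> \<real>\<^sub>\<ge>\<^sub>0" "0 + S (unit_seq j) i \<in> \<real>\<^sub>\<ge>\<^sub>0"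
    using lp_modulus_upper[OF assms(1) unit_seq_pos[of j], of i] unfolding assms(2) .
  then have "norm (S (unit_seq j) i) \<le> norm (0 :: 'a)"
    by (intro nonneg_Reals_norm_mono) (simp_all only: add_0)
  then show ?thesis by simp
qed

lemma lp_modulus_spectral_radius_pos:
  assumes S: "lp_operator p S" and M: "lp_modulus p S M"
    and no_ideal: "\<nexists>V. invariant_ideal p S V"
  shows "0 < spectral_radius p M"
proof -
  have Mop: "lp_operator p M" using M by (simp add: lp_modulus_def)
  have irred: "\<exists>j\<in>A. \<exists>i. i \<notin> A \<and> M (unit_seq j) i \<noteq> 0" if A: "A \<noteq> {}" "A \<noteq> UNIV" for A
    using invariant_ideal_support[OF S A] no_ideal lp_modulus_entry_zero[OF M] by meson
  obtain n where "0 < n" "(M ^^ n) (unit_seq 0) 0 \<noteq> 0"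
    using irreducible_cycle[OF Mop lp_modulus_positive[OF M] irred] by blast
  then show ?thesis
    using spectral_radius_pos_of_cycle[OF Mop lp_modulus_positive[OF M]] by blast
qed

text \<open>
  The set consists of the multiples of \<open>v\<close>. Vanishing of all \<open>2 \<times> 2\<close> minors describes it by
  conditions on coordinates, which shows that it is closed.
\<close>

lemma invariant_subspace_of_eigenvector:
  fixes T :: "'a::{real_normed_field, banach} seq_op"
  assumes T: "lp_operator p T" and v: "lp_eigenvector p T c v"
  shows "invariant_subspace p T {x \<in> lp p. \<forall>i j. x i * v j = x j * v i}"
    (is "invariant_subspace p T ?V")
proof -
  have vl: "v \<in> lp p" and v0: "v \<noteq> (\<lambda>n. 0)" and Tv: "T v = (\<lambda>n. c * v n)"
    using v by (auto simp: lp_eigenvector_def)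
  obtain j where j: "v j \<noteq> 0" using v0 by blast
  have "closedin (lp_topology p) ?V"
  proof (rule lp_closedin_pointwise)
    fix X and x :: "nat \<Rightarrow> 'a"
    assume X: "\<And>k. X k \<in> ?V" and x: "x \<in> lp p" "\<And>i. (\<lambda>k::nat. X k i) \<longlonglongrightarrow> x i"
    have "x i * v l = x l * v i" for i l
    proof (rule LIMSEQ_unique)
      show "(\<lambda>k. X k i * v l) \<longlonglongrightarrow> x i * v l" by (intro tendsto_mult tendsto_const x)
      have "(\<lambda>k. X k i * v l) = (\<lambda>k. X k l * v i)" using X by blast
      then show "(\<lambda>k. X k i * v l) \<longlonglongrightarrow> x l * v i"
        by (simp only:) (intro tendsto_mult tendsto_const x)
    qed
    then show "x \<in> ?V" using x by blast
  qed blast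
  then have "lp_closed_subspace p ?V"
    by (auto simp: lp_closed_subspace_def lp_zero lp_add lp_scale distrib_right mult.assoc)
  moreover have "v \<in> ?V" using vl by (simp add: mult.commute)
  then have "?V \<noteq> {\<lambda>n. 0}" using v0 by blast
  moreover have "?V \<noteq> lp p"
  proof -
    have "unit_seq (Suc j) \<notin> ?V"
    proof
      assume "unit_seq (Suc j) \<in> ?V"
      then have "unit_seq (Suc j) (Suc j) * v j = unit_seq (Suc j) j * v (Suc j)" by blast
      then show False using j by (simp add: unit_seq_def)
    qed
    then show ?thesis using lp_unit_seq(1) by blast
  qed
  moreover have "T ` ?V \<subseteq> ?V"
  proof clarify
    fix x assume x: "x \<in> lp p" "\<forall>i l. x i * v l = x l * v i"
    have "x = (\<lambda>n. x j / v j * v n)" using x(2) j by (auto simp: fun_eq_iff field_simps)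
    then have "T x = (\<lambda>n. x j / v j * (c * v n))"
      using lp_operatorD(3)[OF T vl, of "x j / v j"] Tv by simp
    then show "T x \<in> lp p \<and> (\<forall>i l. T x i * v l = T x l * v i)"
      using lp_operatorD(1)[OF T x(1)] by simp
  qed
  ultimately show ?thesis by (simp add: invariant_subspace_def)
qed

end

theorem theorem3:
  fixes p :: real
    and S M :: "'a::{real_normed_field, banach} seq_op"
  assumes "1 \<le> p"
    and "lp_operator p S"
    and "real_operator S"
    and "quasinilpotent p S"
    and "lp_modulus p S M"
    and "\<nexists>V. invariant_ideal p S V"
    and "lp_compact_op p (neg_part S M)"
  shows "spectral_radius p M > 0
    \<and> (\<exists>v \<in> lp_pos p. lp_eigenvector p M (of_real (spectral_radius p M)) v)
    \<and> (\<exists>V. invariant_subspace p M V)"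
proof -
  interpret lp_exponent p by unfold_locales (rule assms(1))
  let ?r = "spectral_radius p M"
  have M: "lp_operator p M" using assms(5) by (simp add: lp_modulus_def)
  have r: "0 < ?r"
    using lp_modulus_spectral_radius_pos[OF assms(2,5,6)] .
  have gap: "spectral_radius p S < ?r"
    using assms(4) r by (simp add: quasinilpotent_def)
  have K: "neg_part S M x \<in> lp p" if "x \<in> lp p" for x
    using lp_scale(1)[OF lp_diff(1)[OF lp_operatorD(1)[OF M that] lp_operatorD(1)[OF assms(2) that]],
        of "1 / 2"]
    by (simp add: neg_part_def)
  have sum: "M x i = S x i + 2 * neg_part S M x i" for x i
    by (simp add: neg_part_def field_simps)
  obtain v where v: "v \<in> lp_pos p" "v \<noteq> (\<lambda>n. 0)" "M v = (\<lambda>n. of_real ?r * v n)"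
    using positive_eigenvector_of_compact_perturbation
      [OF assms(2) M lp_modulus_positive[OF assms(5)] gap assms(7) K sum] .
  then have "lp_eigenvector p M (of_real ?r) v"
    by (simp add: lp_eigenvector_def lp_posD)
  then show ?thesis
    using r v(1) invariant_subspace_of_eigenvector[OF M] by blast
qed

end
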